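(* Let $a,T\in\mathcal{A}$ be freely independent with $T\neq0$ R-diagonal, let $z\in\mathbb{C}$, and put $\mu_1=\widetilde\mu_{|a-z|}$, $\mu_2=\widetilde\mu_{|T|}$ and $\mu=\mu_1\boxplus\mu_2$. Suppose that $0\notin\operatorname{supp}(\mu)$. If $z\in\Theta_{\rm out}$, i.e. $m_2(\mu_2)<1/m_{-2}(\mu_1)$, then there exists $\delta>0$ such that for every $x\in(-\delta,\delta)$ we have $\omega_1(x)\in\mathbb{R}$ and $\omega_1'(x)>1$. Moreover, $(-\omega_1(\delta),\omega_1(\delta))\cap\operatorname{supp}(\mu_1)=\emptyset$.
   Context: $(\mathcal{A},\tau)$ is a finite von Neumann algebra with a faithful normal tracial state. For a positive $x\in\mathcal{A}$, $\mu_x$ is its spectral distribution under $\tau$, and $\widetilde\nu(B)=\frac12[\nu(B)+\nu(-B)]$ is the symmetrization of a measure $\nu$ on $\mathbb{R}$. For a probability measure $\nu$ on $\mathbb{R}$, $m_{p}(\nu)=\int|t|^{p}\,d\nu(t)\in[0,\infty]$ for $p=2,-2$ ($1/\infty=0$), and $G_\nu(w)=\int\frac{d\nu(t)}{w-t}$. $\boxplus$ is free additive convolution. $\omega_1,\omega_2$ are the subordination functions of $\mu_1\boxplus\mu_2$: the unique continuous functions $\overline{\mathbb{C}^+}\to\overline{\mathbb{C}^+}\cup\{\infty\}$, analytic on $\mathbb{C}^+$, with $G_{\mu}(w)=G_{\mu_1}(\omega_1(w))=G_{\mu_2}(\omega_2(w))$ and $\omega_1(w)+\omega_2(w)=w+1/G_\mu(w)$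 for $w\in\mathbb{C}^+$, and $\lim_{y\to+\infty}\omega_j(iy)/(iy)=1$. (They depend on $z$.) The values $\omega_1(x)$ for real $x$ refer to this continuous extension. *)

theory Defs
  imports "HOL-Analysis.Analysis"
begin

section \<open>Complex Hilbert spaces and their operators\<close>

text \<open>The inner product \<open>cinner\<close> is linear in the first argument. Its real part is the real inner
  product of the class \<^class>\<open>real_inner\<close>, so norm and topology are those of the library.\<close>

class complex_hilbert_space = real_inner + complete_space +
  fixes scaleC :: "complex \<Rightarrow> 'a \<Rightarrow> 'a"
    and cinner :: "'a \<Rightarrow> 'a \<Rightarrow> complex"
  assumes scaleC_of_real: "scaleC (complex_of_real r) x = r *\<^sub>R x"
    and scaleC_add_left: "scaleC (c + d) x = scaleC c x + scaleC d x"
    and scaleC_add_right: "scaleC c (x + y) = scaleC c x + scaleC c y"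
    and scaleC_scaleC: "scaleC c (scaleC d x) = scaleC (c * d) x"
    and cinner_add_left: "cinner (x + y) w = cinner x w + cinner y w"
    and cinner_scaleC_left: "cinner (scaleC c x) w = c * cinner x w"
    and cinner_commute: "cinner x y = cnj (cinner y x)"
    and Re_cinner: "Re (cinner x y) = inner x y"

text \<open>Operators are functions \<open>'h \<Rightarrow> 'h\<close>: the product is composition, the unit is \<^const>\<open>id\<close>, and the
  linear operations are pointwise.\<close>

definition bounded_operators :: "('h::complex_hilbert_space \<Rightarrow> 'h) set" where
  "bounded_operators = {x. bounded_linear x \<and> (\<forall>c \<xi>. x (scaleC c \<xi>) = scaleC c (x \<xi>))}"

definition is_adjoint :: "('h::complex_hilbert_space \<Rightarrow> 'h) \<Rightarrow> ('h \<Rightarrow> 'h) \<Rightarrow> bool" where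
  "is_adjoint x y \<longleftrightarrow> (\<forall>\<xi> \<eta>. cinner (x \<xi>) \<eta> = cinner \<xi> (y \<eta>))"

definition adj :: "('h::complex_hilbert_space \<Rightarrow> 'h) \<Rightarrow> ('h \<Rightarrow> 'h)" where
  "adj x = (THE y. is_adjoint x y)"

definition selfadjoint :: "('h::complex_hilbert_space \<Rightarrow> 'h) \<Rightarrow> bool" where
  "selfadjoint x \<longleftrightarrow> x \<in> bounded_operators \<and> is_adjoint x x"

definition positive_operator :: "('h::complex_hilbert_space \<Rightarrow> 'h) \<Rightarrow> bool" where
  "positive_operator x \<longleftrightarrow>
     x \<in> bounded_operators \<and> (\<forall>\<xi>. Im (cinner (x \<xi>) \<xi>) = 0 \<and> 0 \<le> Re (cinner (x \<xi>) \<xi>))"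

definition operator_le :: "('h::complex_hilbert_space \<Rightarrow> 'h) \<Rightarrow> ('h \<Rightarrow> 'h) \<Rightarrow> bool" where
  "operator_le x y \<longleftrightarrow> positive_operator (\<lambda>\<xi>. y \<xi> - x \<xi>)"

definition projection :: "('h::complex_hilbert_space \<Rightarrow> 'h) \<Rightarrow> bool" where
  "projection e \<longleftrightarrow> selfadjoint e \<and> e \<circ> e = e"

text \<open>\<open>is_abs x p\<close> says that \<open>p = |x|\<close>, the (unique) positive square root of \<open>x\<^sup>* x\<close>.\<close>

definition is_abs :: "('h::complex_hilbert_space \<Rightarrow> 'h) \<Rightarrow> ('h \<Rightarrow> 'h) \<Rightarrow> bool" where
  "is_abs x p \<longleftrightarrow> positive_operator p \<and> p \<circ> p = adj x \<circ> x"


section \<open>Finite von Neumann algebras with a faithful normal tracial state\<close>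

definition commutant :: "('h::complex_hilbert_space \<Rightarrow> 'h) set \<Rightarrow> ('h \<Rightarrow> 'h) set" where
  "commutant S = {y \<in> bounded_operators. \<forall>x\<in>S. x \<circ> y = y \<circ> x}"

definition von_neumann_algebra :: "('h::complex_hilbert_space \<Rightarrow> 'h) set \<Rightarrow> bool" where
  "von_neumann_algebra A \<longleftrightarrow>
     (\<forall>x\<in>A. \<exists>y\<in>A. is_adjoint x y) \<and> commutant (commutant A) = A"

definition is_lub_in :: "('h::complex_hilbert_space \<Rightarrow> 'h) set \<Rightarrow> ('h \<Rightarrow> 'h) set \<Rightarrow> ('h \<Rightarrow> 'h) \<Rightarrow> bool" where
  "is_lub_in A D s \<longleftrightarrow> s \<in> A \<and> selfadjoint s \<and> (\<forall>d\<in>D. operator_le d s) \<and>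
     (\<forall>u\<in>A. selfadjoint u \<and> (\<forall>d\<in>D. operator_le d u) \<longrightarrow> operator_le s u)"

definition normal_functional ::
    "('h::complex_hilbert_space \<Rightarrow> 'h) set \<Rightarrow> (('h \<Rightarrow> 'h) \<Rightarrow> complex) \<Rightarrow> bool" where
  "normal_functional A \<tau> \<longleftrightarrow>
     (\<forall>D s. D \<noteq> {} \<and> D \<subseteq> A \<and> (\<forall>d\<in>D. selfadjoint d) \<and>
            (\<forall>c\<in>D. \<forall>d\<in>D. \<exists>e\<in>D. operator_le c e \<and> operator_le d e) \<and> is_lub_in A D s
            \<longrightarrow> Re (\<tau> s) = (SUP d\<in>D. Re (\<tau> d)))"

locale tracial_von_neumann_algebra =
  fixes A :: "('h::complex_hilbert_space \<Rightarrow> 'h) set"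
    and \<tau> :: "('h \<Rightarrow> 'h) \<Rightarrow> complex"
  assumes vna: "von_neumann_algebra A"
    and finite_vna: "v \<in> A \<Longrightarrow> adj v \<circ> v = id \<Longrightarrow> v \<circ> adj v = id"
    and trace_add: "x \<in> A \<Longrightarrow> y \<in> A \<Longrightarrow> \<tau> (\<lambda>\<xi>. x \<xi> + y \<xi>) = \<tau> x + \<tau> y"
    and trace_scale: "x \<in> A \<Longrightarrow> \<tau> (\<lambda>\<xi>. scaleC c (x \<xi>)) = c * \<tau> x"
    and trace_id: "\<tau> id = 1"
    and trace_positive: "x \<in> A \<Longrightarrow> Im (\<tau> (adj x \<circ> x)) = 0 \<and> 0 \<le> Re (\<tau> (adj x \<circ> x))"
    and trace_faithful: "x \<in> A \<Longrightarrow> \<tau> (adj x \<circ> x) = 0 \<Longrightarrow> x = (\<lambda>_. 0)"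
    and trace_commute: "x \<in> A \<Longrightarrow> y \<in> A \<Longrightarrow> \<tau> (x \<circ> y) = \<tau> (y \<circ> x)"
    and trace_normal: "normal_functional A \<tau>"


section \<open>Spectral distributions\<close>

text \<open>\<open>E\<close> is the spectral (projection-valued) measure of the bounded selfadjoint operator \<open>x\<close>.
  Countable additivity holds in the strong operator topology, and \<open>x = \<integral> t dE(t)\<close> is
  expressed weakly, through the measures \<open>\<langle>E(\<cdot>)\<xi>,\<xi>\<rangle>\<close>.\<close>

definition is_spectral_measure ::
    "('h::complex_hilbert_space \<Rightarrow> 'h) \<Rightarrow> (real set \<Rightarrow> 'h \<Rightarrow> 'h) \<Rightarrow> bool" where
  "is_spectral_measure x E \<longleftrightarrow>
     (\<forall>B\<in>sets borel. projection (E B)) \<and>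
     E UNIV = id \<and>
     (\<forall>B\<in>sets borel. \<forall>C\<in>sets borel. E (B \<inter> C) = E B \<circ> E C) \<and>
     (\<forall>F :: nat \<Rightarrow> real set. range F \<subseteq> sets borel \<and> disjoint_family F
        \<longrightarrow> (\<forall>\<xi>. (\<lambda>n. E (F n) \<xi>) sums E (\<Union>n. F n) \<xi>)) \<and>
     (\<exists>K. E {- K..K} = id) \<and>
     (\<forall>\<xi>. cinner (x \<xi>) \<xi> =
        complex_of_real (\<integral>t. t \<partial>(measure_of UNIV (sets borel) (\<lambda>B. ennreal (Re (cinner (E B \<xi>) \<xi>))))))"

text \<open>\<open>\<nu>(B) = \<tau>(E\<^sub>x(B))\<close>.\<close>

definition spectral_distribution ::
    "('h::complex_hilbert_space \<Rightarrow> 'h) set \<Rightarrow> (('h \<Rightarrow> 'h) \<Rightarrow> complex) \<Rightarrow> ('h \<Rightarrow> 'h) \<Rightarrow> real measure \<Rightarrow> bool" where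
  "spectral_distribution A \<tau> x \<nu> \<longleftrightarrow> x \<in> A \<and> selfadjoint x \<and> sets \<nu> = sets borel \<and>
     (\<exists>E. is_spectral_measure x E \<and>
          (\<forall>B\<in>sets borel. E B \<in> A \<and> emeasure \<nu> B = ennreal (Re (\<tau> (E B)))))"


section \<open>Freeness and R-diagonality\<close>

inductive_set star_algebra :: "('h::complex_hilbert_space \<Rightarrow> 'h) set \<Rightarrow> ('h \<Rightarrow> 'h) set" for S where
  gen: "x \<in> S \<Longrightarrow> x \<in> star_algebra S"
| one: "id \<in> star_algebra S"
| add: "x \<in> star_algebra S \<Longrightarrow> y \<in> star_algebra S \<Longrightarrow> (\<lambda>\<xi>. x \<xi> + y \<xi>) \<in> star_algebra S"
| scale: "x \<in> star_algebra S \<Longrightarrow> (\<lambda>\<xi>. scaleC c (x \<xi>)) \<in> star_algebra S"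
| mult: "x \<in> star_algebra S \<Longrightarrow> y \<in> star_algebra S \<Longrightarrow> x \<circ> y \<in> star_algebra S"
| star: "x \<in> star_algebra S \<Longrightarrow> adj x \<in> star_algebra S"

definition op_prod :: "('h \<Rightarrow> 'h) list \<Rightarrow> ('h \<Rightarrow> 'h)" where
  "op_prod xs = foldr (\<circ>) xs id"

text \<open>In the next definition the Boolean in a pair records the algebra the factor is taken from:
  alternating products of centred elements are centred.\<close>

definition freely_independent ::
    "(('h::complex_hilbert_space \<Rightarrow> 'h) \<Rightarrow> complex) \<Rightarrow> ('h \<Rightarrow> 'h) \<Rightarrow> ('h \<Rightarrow> 'h) \<Rightarrow> bool" where
  "freely_independent \<tau> x y \<longleftrightarrow>
     (\<forall>ps :: (bool \<times> ('h \<Rightarrow> 'h)) list.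
        ps \<noteq> [] \<and> distinct_adj (map fst ps) \<and>
        (\<forall>(b, u)\<in>set ps. u \<in> star_algebra {if b then x else y} \<and> \<tau> u = 0)
        \<longrightarrow> \<tau> (op_prod (map snd ps)) = 0)"

definition noncrossing_partitions :: "nat \<Rightarrow> nat set set set" where
  "noncrossing_partitions n =
     {\<pi>. partition_on {..<n} \<pi> \<and>
         (\<forall>V\<in>\<pi>. \<forall>W\<in>\<pi>. V \<noteq> W \<longrightarrow>
            \<not> (\<exists>i j k l. i < j \<and> j < k \<and> k < l \<and> i \<in> V \<and> k \<in> V \<and> j \<in> W \<and> l \<in> W))}"

text \<open>\<open>\<kappa> [x\<^sub>1, \<dots>, x\<^sub>n]\<close> is the free cumulant of \<open>x\<^sub>1, \<dots>, x\<^sub>n\<close>. The moment-cumulant formula determines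
  \<open>\<kappa>\<close> on the nonempty lists of elements of \<open>A\<close>, since the one-block partition contributes
  \<open>\<kappa> [x\<^sub>1, \<dots>, x\<^sub>n]\<close> itself.\<close>

definition is_free_cumulants ::
    "('h \<Rightarrow> 'h) set \<Rightarrow> (('h \<Rightarrow> 'h) \<Rightarrow> complex) \<Rightarrow> (('h \<Rightarrow> 'h) list \<Rightarrow> complex) \<Rightarrow> bool" where
  "is_free_cumulants A \<tau> \<kappa> \<longleftrightarrow>
     (\<forall>xs. xs \<noteq> [] \<and> set xs \<subseteq> A \<longrightarrow>
        \<tau> (op_prod xs) = (\<Sum>\<pi>\<in>noncrossing_partitions (length xs). \<Prod>V\<in>\<pi>. \<kappa> (nths xs V)))"

text \<open>R-diagonality in the sense of Nica and Speicher: among the free cumulants with entries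
  \<open>T\<close> and \<open>T\<^sup>*\<close>, only the alternating ones of even length can be nonzero.\<close>

definition R_diagonal ::
    "('h::complex_hilbert_space \<Rightarrow> 'h) set \<Rightarrow> (('h \<Rightarrow> 'h) \<Rightarrow> complex) \<Rightarrow> ('h \<Rightarrow> 'h) \<Rightarrow> bool" where
  "R_diagonal A \<tau> T \<longleftrightarrow> T \<in> A \<and>
     (\<exists>\<kappa>. is_free_cumulants A \<tau> \<kappa> \<and>
          (\<forall>w :: bool list. w \<noteq> [] \<and> \<not> (even (length w) \<and> distinct_adj w)
             \<longrightarrow> \<kappa> (map (\<lambda>b. if b then T else adj T) w) = 0))"

text \<open>\<open>\<mu> = \<mu>\<^sub>1 \<boxplus> \<mu>\<^sub>2\<close> for compactly supported measures: the distribution of a sum of free selfadjoint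
  variables with distributions \<open>\<mu>\<^sub>1\<close> and \<open>\<mu>\<^sub>2\<close>. The first argument only carries the type of the
  Hilbert space on which these variables are realized; HOL cannot quantify over it, so it has to
  stay universally quantified where this occurs as a hypothesis.\<close>

definition is_free_additive_convolution ::
    "'k::complex_hilbert_space itself \<Rightarrow> real measure \<Rightarrow> real measure \<Rightarrow> real measure \<Rightarrow> bool" where
  "is_free_additive_convolution _ \<mu>1 \<mu>2 \<mu> \<longleftrightarrow>
     (\<exists>(B :: ('k \<Rightarrow> 'k) set) \<phi> x y.
        tracial_von_neumann_algebra B \<phi> \<and> freely_independent \<phi> x y \<and>
        spectral_distribution B \<phi> x \<mu>1 \<and> spectral_distribution B \<phi> y \<mu>2 \<and>
        spectral_distribution B \<phi> (\<lambda>\<xi>. x \<xi> + y \<xi>) \<mu>)"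


section \<open>Measures on the real line and subordination\<close>

definition symmetrization :: "real measure \<Rightarrow> real measure" where
  "symmetrization \<nu> =
     measure_of UNIV (sets borel) (\<lambda>B. (emeasure \<nu> B + emeasure \<nu> (uminus ` B)) / 2)"

definition measure_support :: "real measure \<Rightarrow> real set" where
  "measure_support \<nu> = {x. \<forall>U. open U \<and> x \<in> U \<longrightarrow> emeasure \<nu> U \<noteq> 0}"

definition moment_2 :: "real measure \<Rightarrow> ennreal" where
  "moment_2 \<nu> = (\<integral>\<^sup>+t. ennreal (t\<^sup>2) \<partial>\<nu>)"

text \<open>In \<^typ>\<open>ennreal\<close> the inverse of \<open>0\<close> is \<open>\<infinity>\<close>, as required for \<open>|t|\<close> to the power \<open>-2\<close> at \<open>t = 0\<close>.\<close>

definition moment_minus_2 :: "real measure \<Rightarrow> ennreal" where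
  "moment_minus_2 \<nu> = (\<integral>\<^sup>+t. inverse (ennreal (t\<^sup>2)) \<partial>\<nu>)"

definition cauchy_transform :: "real measure \<Rightarrow> complex \<Rightarrow> complex" where
  "cauchy_transform \<nu> w = (\<integral>t. 1 / (w - complex_of_real t) \<partial>\<nu>)"

definition upper_half_plane :: "complex set" where
  "upper_half_plane = {w. 0 < Im w}"

definition closed_upper_half_plane :: "complex set" where
  "closed_upper_half_plane = {w. 0 \<le> Im w}"

text \<open>The space \<open>\<close>closed upper half-plane\<open> \<union> {\<infinity>}\<close> is the one-point compactification, with \<^const>\<open>None\<close>
  for \<open>\<infinity>\<close>. The values on the open half-plane are finite: a nonconstant analytic function with values
  in the closed half-plane and \<open>\<infinity>\<close> is open, hence has no poles.\<close>

definition is_subordination_pair ::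
    "real measure \<Rightarrow> real measure \<Rightarrow> real measure \<Rightarrow>
     (complex \<Rightarrow> complex option) \<Rightarrow> (complex \<Rightarrow> complex option) \<Rightarrow> bool" where
  "is_subordination_pair \<mu>1 \<mu>2 \<mu> \<omega>1 \<omega>2 \<longleftrightarrow>
     (\<forall>\<omega>\<in>{\<omega>1, \<omega>2}.
        continuous_map (top_of_set closed_upper_half_plane)
          (Alexandroff_compactification (top_of_set closed_upper_half_plane)) \<omega> \<and>
        (\<forall>w\<in>upper_half_plane. \<omega> w \<noteq> None) \<and>
        (\<lambda>w. the (\<omega> w)) analytic_on upper_half_plane \<and>
        ((\<lambda>y::real. the (\<omega> (\<i> * complex_of_real y)) / (\<i> * complex_of_real y)) \<longlongrightarrow> 1) at_top) \<and>
     (\<forall>w\<in>upper_half_plane.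
        cauchy_transform \<mu> w = cauchy_transform \<mu>1 (the (\<omega>1 w)) \<and>
        cauchy_transform \<mu> w = cauchy_transform \<mu>2 (the (\<omega>2 w)) \<and>
        the (\<omega>1 w) + the (\<omega>2 w) = w + 1 / cauchy_transform \<mu> w)"

end

theory Submission
  imports Defs "HOL-Complex_Analysis.Complex_Analysis" "HOL-Probability.Distribution_Functions"
begin

text \<open>Write \<open>F\<^sub>j = 1 / G\<^sub>j\<close> for the reciprocal Cauchy transform of \<open>\<mu>\<^sub>j\<close>. The subordination equations
  read \<open>\<omega>\<^sub>1 = w + h\<^sub>2(\<omega>\<^sub>2)\<close>, \<open>\<omega>\<^sub>2 = w + h\<^sub>1(\<omega>\<^sub>1)\<close> with \<open>h\<^sub>j(\<omega>) = F\<^sub>j(\<omega>) - \<omega>\<close>, and \<open>h\<^sub>j\<close> vanishes at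
  infinity. There they are a contraction, so the symmetry of \<open>\<mu>\<^sub>j\<close> forces \<open>\<omega>\<^sub>j\<close> to preserve the
  imaginary axis, first near infinity and then everywhere by analytic continuation. As \<open>0\<close> lies
  outside the support of \<open>\<mu>\<close>, \<open>G\<close> vanishes at \<open>0\<close>, so each \<open>\<omega>\<^sub>j(0)\<close> is \<open>0\<close> or \<open>\<infinity>\<close> and exactly one of
  them is \<open>\<infinity>\<close>.

  If \<open>\<omega>\<^sub>2(0) = \<infinity>\<close>, inverting \<open>G\<^sub>2\<close> near infinity exhibits \<open>\<omega>\<^sub>1 = w + h\<^sub>2(G\<^sub>2\<^sup>-\<^sup>1(G(w)))\<close> as an analytic
  function near \<open>0\<close>, real on the reals, with derivative \<open>1 + m\<^sub>2(\<mu>\<^sub>2) m\<^sub>-\<^sub>2(\<mu>) > 1\<close> at \<open>0\<close>. Comparing imaginary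
  parts of \<open>G\<^sub>1(\<omega>\<^sub>1(w)) = G(w)\<close> bounds \<open>\<integral> |\<omega>\<^sub>1(w) - t|\<^sup>-\<^sup>2 d\<mu>\<^sub>1(t)\<close>, which makes the mass of an interval of
  length \<open>e\<close> near \<open>0\<close> of order \<open>e\<^sup>2\<close>, hence zero.

  If \<open>\<omega>\<^sub>1(0) = \<infinity>\<close>, the same expansion of \<open>\<omega>\<^sub>2\<close> and Jensen's inequality give
  \<open>m\<^sub>2(\<mu>\<^sub>2) > m\<^sub>2(\<mu>\<^sub>1) \<ge> 1 / m\<^sub>-\<^sub>2(\<mu>\<^sub>1)\<close>, which the hypothesis excludes.\<close>

section \<open>Spectral distributions as symmetric laws\<close>

lemma cinner_zero_left: "cinner (0::'h::complex_hilbert_space) x = 0"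
  using cinner_add_left[of 0 0 x] by simp

lemma adj_eqI:
  assumes "is_adjoint x y"
  shows "adj x = y"
  unfolding adj_def
proof (rule the_equality[where P = "is_adjoint x"])
  fix y' assume "is_adjoint x y'"
  with assms have "inner \<xi> (y' \<eta>) = inner \<xi> (y \<eta>)" for \<xi> \<eta>
    unfolding is_adjoint_def by (metis Re_cinner)
  then show "y' = y"
    by (metis ext vector_eq_rdot inner_commute)
qed fact

text \<open>Polarization: for selfadjoint \<open>q\<close> the real form
  \<open>inner (q x) y\<close> is symmetric, so it vanishes together with its quadratic
  form.\<close>

lemma selfadjoint_eq_zero:
  assumes q: "selfadjoint q" and zero: "\<And>\<xi>. cinner (q \<xi>) \<xi> = 0"
  shows "q \<xi> = 0"
proof -
  have lin: "bounded_linear q" and adj: "is_adjoint q q"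
    using q by (auto simp: selfadjoint_def bounded_operators_def)
  have z: "inner (q x) x = 0" for x
    using zero[of x] by (metis Re_cinner zero_complex.simps(1))
  have "inner (q (\<xi> + \<eta>)) (\<xi> + \<eta>) = 0" for \<eta> by (rule z)
  then have "inner (q \<xi>) \<eta> + inner (q \<eta>) \<xi> = 0" for \<eta>
    by (simp add: z linear_add[OF bounded_linear.linear[OF lin]] inner_add_left inner_add_right add.commute)
  moreover have "inner (q \<eta>) \<xi> = inner (q \<xi>) \<eta>" for \<eta>
    using adj unfolding is_adjoint_def by (metis Re_cinner inner_commute)
  ultimately have "inner (q \<xi>) \<eta> = 0" for \<eta>
    by (metis add.inverse_neutral mult_2 mult_eq_0_iff zero_neq_numeral)
  then show ?thesis
    by (metis inner_eq_zero_iff)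
qed

text \<open>If all mass sat at 0, faithfulness of the trace would kill the spectral projection of
  \<open>- {0}\<close>, whence \<open>q = 0\<close> and, from \<open>|T| = 0\<close>, also
  \<open>T = 0\<close>. This is the source of the positivity of \<open>m2\<close> for
  \<open>\<mu>2\<close>.\<close>

lemma spectral_distribution_nonzero:
  assumes "tracial_von_neumann_algebra A \<tau>" "T \<in> A" "T \<noteq> (\<lambda>_. 0)"
    and abs: "is_abs T q" and spec: "spectral_distribution A \<tau> q \<nu>"
  shows "emeasure \<nu> (- {0}) \<noteq> 0"
proof
  assume null: "emeasure \<nu> (- {0}) = 0"
  interpret tracial_von_neumann_algebra A \<tau> by fact
  from spec obtain E where E: "is_spectral_measure q E" and q: "selfadjoint q"
    and EA: "\<And>B. B \<in> sets borel \<Longrightarrow> E B \<in> A \<and> emeasure \<nu> B = ennreal (Re (\<tau> (E B)))"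
    unfolding spectral_distribution_def by blast
  let ?e = "E (- {0})"
  have e: "?e \<in> A" "ennreal (Re (\<tau> ?e)) = 0" using EA[of "- {0}"] null by auto
  have "projection ?e" using E by (auto simp: is_spectral_measure_def)
  then have "adj ?e = ?e" "?e \<circ> ?e = ?e"
    by (auto simp: projection_def selfadjoint_def intro!: adj_eqI)
  then have "\<tau> (adj ?e \<circ> ?e) = 0"
    using trace_positive[OF e(1)] e(2) by (simp add: complex_eq_iff ennreal_eq_0_iff)
  then have e0: "?e = (\<lambda>_. 0)" by (rule trace_faithful[OF e(1)])
  have "cinner (q \<xi>) \<xi> = 0" for \<xi>
  proof -
    let ?M = "measure_of UNIV (sets borel) (\<lambda>B. ennreal (Re (cinner (E B \<xi>) \<xi>)))"
    have sets: "sets ?M = sets borel"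
      by (metis sets_measure_of_conv space_borel sets.sets_measure_of_eq sets.space_closed)
    \<comment> \<open>A set function that fails to be a measure would give the default value 0, so
      the claim holds without checking countable additivity of \<open>?M\<close>.\<close>
    have "emeasure ?M (- {0}) = 0"
      by (simp add: emeasure_measure_of_conv e0 cinner_zero_left)
    then have "AE t in ?M. t = 0"
      by (subst AE_iff_measurable[where N = "- {0}"]) (auto simp: sets space_measure_of_conv)
    then have "(\<integral>t. t \<partial>?M) = 0"
      by (rule integral_eq_zero_AE)
    then show ?thesis
      using E unfolding is_spectral_measure_def by simp
  qed
  then have q0: "q \<xi> = 0" for \<xi> by (rule selfadjoint_eq_zero[OF q])
  obtain S where S: "is_adjoint T S" using vna \<open>T \<in> A\<close> unfolding von_neumann_algebra_def by blast
  have "S (T \<xi>) = 0" for \<xi>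
    using abs adj_eqI[OF S] q0 unfolding is_abs_def by (metis comp_apply)
  then have "cinner (T \<xi>) (T \<xi>) = 0" for \<xi>
    using S cinner_zero_left cinner_commute unfolding is_adjoint_def by (metis complex_cnj_zero)
  then have "inner (T \<xi>) (T \<xi>) = 0" for \<xi>
    by (metis Re_cinner zero_complex.simps(1))
  then show False using \<open>T \<noteq> _\<close> by (auto simp: fun_eq_iff)
qed

lemma spectral_distribution_bounded:
  assumes "tracial_von_neumann_algebra A \<tau>" and spec: "spectral_distribution A \<tau> x \<nu>"
  obtains K where "real_distribution \<nu>" "K > 0" "AE t in \<nu>. \<bar>t\<bar> \<le> K"
proof -
  interpret tracial_von_neumann_algebra A \<tau> by fact
  from spec obtain E where E: "is_spectral_measure x E" and sets: "sets \<nu> = sets borel"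
    and EA: "\<And>B. B \<in> sets borel \<Longrightarrow> E B \<in> A \<and> emeasure \<nu> B = ennreal (Re (\<tau> (E B)))"
    unfolding spectral_distribution_def by blast
  have space: "space \<nu> = UNIV" using sets_eq_imp_space_eq[OF sets] by simp
  have "emeasure \<nu> UNIV = 1"
    using EA[of UNIV] E trace_id by (simp add: is_spectral_measure_def)
  then have prob: "prob_space \<nu>" by (intro prob_spaceI) (simp add: space)
  obtain K where K: "E {- K..K} = id" using E by (auto simp: is_spectral_measure_def)
  \<comment> \<open>Multiplicativity of \<open>E\<close> turns the projection outside the interval
    into the projection of the empty set.\<close>
  have "E (- {- K..K}) = E (- {- K..K}) \<circ> E {- K..K}" by (simp add: K)
  also have "\<dots> = E (- {- K..K} \<inter> {- K..K})"
    using E unfolding is_spectral_measure_def by (metis atLeastAtMost_borel borel_comp)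
  finally have "emeasure \<nu> (- {- K..K}) = emeasure \<nu> {}"
    using EA[of "- {- K..K}"] EA[of "{}"] by simp
  then have "AE t in \<nu>. t \<in> {-K..K}"
    by (subst AE_iff_measurable[where N = "- {- K..K}"]) (auto simp: sets space)
  \<comment> \<open>The given \<open>K\<close> may fail to be positive;
    \<open>\<bar>K\<bar> + 1\<close> is a positive bound in every case.\<close>
  then have "AE t in \<nu>. \<bar>t\<bar> \<le> \<bar>K\<bar> + 1" by eventually_elim auto
  then show thesis using that[of "\<bar>K\<bar> + 1"] prob sets
    by (simp add: real_distribution_def real_distribution_axioms_def)
qed

section \<open>Symmetric laws of bounded support, and symmetrization\<close>

locale symmetric_law = real_distribution \<nu> for K :: real and \<nu> :: "real measure" +
  assumes K_pos: "K > 0"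
    and bounded: "AE t in \<nu>. \<bar>t\<bar> \<le> K"
    and symmetric: "distr \<nu> borel uminus = \<nu>"

lemma image_uminus_eq_vimage: "uminus ` C = uminus -` (C :: real set)"
  by (auto simp: image_iff) (metis minus_minus)

lemma image_uminus_borel: "C \<in> sets borel \<Longrightarrow> uminus ` C \<in> sets (borel :: real measure)"
  using measurable_sets[of uminus borel borel C] by (simp add: image_uminus_eq_vimage)

text \<open>\<open>symmetrization\<close> is built by \<open>measure_of\<close>, so its values are
  the intended ones only once countable additivity is known. The reflected summand is countably
  additive because it is the pushforward \<open>distr \<nu> borel uminus\<close>.\<close>

lemma
  assumes sets: "sets \<nu> = sets borel"
  shows sets_symmetrization: "sets (symmetrization \<nu>) = sets borel"
    and space_symmetrization: "space (symmetrization \<nu>) = UNIV"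
    and emeasure_symmetrization: "B \<in> sets borel \<Longrightarrow>
      emeasure (symmetrization \<nu>) B = (emeasure \<nu> B + emeasure \<nu> (uminus ` B)) / 2"
proof -
  show sets': "sets (symmetrization \<nu>) = sets borel"
    unfolding symmetrization_def
    by (metis sets_measure_of_conv space_borel sets.sets_measure_of_eq sets.space_closed)
  show "space (symmetrization \<nu>) = UNIV"
    by (simp add: symmetrization_def space_measure_of_conv)
  assume B: "B \<in> sets borel"
  have em: "emeasure \<nu> (uminus ` C) = emeasure (distr \<nu> borel uminus) C" if "C \<in> sets borel" for C
    using that sets_eq_imp_space_eq[OF sets]
    by (subst emeasure_distr) (auto simp: image_uminus_eq_vimage measurable_cong_sets[OF sets refl])
  show "emeasure (symmetrization \<nu>) B = (emeasure \<nu> B + emeasure \<nu> (uminus ` B)) / 2"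
  proof (rule emeasure_measure_of[OF symmetrization_def])
    show "positive (sets (symmetrization \<nu>)) (\<lambda>B. (emeasure \<nu> B + emeasure \<nu> (uminus ` B)) / 2)"
      by (simp add: positive_def)
    show "countably_additive (sets (symmetrization \<nu>))
        (\<lambda>B. (emeasure \<nu> B + emeasure \<nu> (uminus ` B)) / 2)"
    proof (rule countably_additiveI)
      fix F :: "nat \<Rightarrow> real set"
      assume F: "range F \<subseteq> sets (symmetrization \<nu>)" "disjoint_family F"
        and UF: "\<Union> (range F) \<in> sets (symmetrization \<nu>)"
      then have Fi: "F i \<in> sets borel" for i by (auto simp: sets')
      have "(\<Sum>i. (emeasure \<nu> (F i) + emeasure \<nu> (uminus ` F i)) / 2) =
          (\<Sum>i. emeasure \<nu> (F i) + emeasure (distr \<nu> borel uminus) (F i)) / 2"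
        by (simp add: divide_ennreal_def em[OF Fi] ennreal_suminf_multc)
      also have "(\<Sum>i. emeasure \<nu> (F i) + emeasure (distr \<nu> borel uminus) (F i)) =
          emeasure \<nu> (\<Union> (range F)) + emeasure (distr \<nu> borel uminus) (\<Union> (range F))"
        using F Fi by (subst suminf_add[symmetric]) (auto simp: sets intro!: arg_cong2[where f="(+)"] suminf_emeasure)
      finally show "(\<Sum>i. (emeasure \<nu> (F i) + emeasure \<nu> (uminus ` F i)) / 2) =
          (emeasure \<nu> (\<Union> (range F)) + emeasure \<nu> (uminus ` \<Union> (range F))) / 2"
        using UF by (subst em) (auto simp: sets')
    qed
  qed (use B sets' in auto)
qed

lemma symmetric_law_symmetrization:
  assumes "real_distribution \<nu>" and K: "K > 0" and AE: "AE t in \<nu>. \<bar>t\<bar> \<le> K"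
  shows "symmetric_law K (symmetrization \<nu>)"
proof -
  interpret real_distribution \<nu> by fact
  note sets = events_eq_borel
  note [simp] = sets_symmetrization[OF sets] space_symmetrization[OF sets]
  have space: "space \<nu> = UNIV" using sets_eq_imp_space_eq[OF sets] by simp
  have one: "emeasure \<nu> UNIV = 1" using emeasure_space_1 by (simp add: space)
  have "emeasure \<nu> (- {-K..K}) = 0"
    using AE by (subst (asm) AE_iff_measurable[where N = "- {- K..K}"]) (auto simp: sets space)
  moreover have "uminus ` (- {-K..K}) = - {-K..K}" by (auto simp: image_uminus_eq_vimage)
  ultimately have null: "emeasure (symmetrization \<nu>) (- {-K..K}) = 0"
    by (simp add: emeasure_symmetrization[OF sets])
  show ?thesis
  proof (intro symmetric_law.intro real_distribution.intro real_distribution_axioms.intro symmetric_law_axioms.intro)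
    show "prob_space (symmetrization \<nu>)"
      by (rule prob_spaceI) (simp add: emeasure_symmetrization[OF sets] one surj_def)
    show "AE t in symmetrization \<nu>. \<bar>t\<bar> \<le> K"
      using null by (subst AE_iff_measurable[where N = "- {- K..K}"]) auto
    show "distr (symmetrization \<nu>) borel uminus = symmetrization \<nu>"
    proof (rule measure_eqI)
      fix B assume "B \<in> sets (distr (symmetrization \<nu>) borel uminus)"
      then have B: "B \<in> sets borel" by simp
      have "emeasure (distr (symmetrization \<nu>) borel uminus) B
          = emeasure (symmetrization \<nu>) (uminus ` B)"
        using B by (subst emeasure_distr)
          (auto simp: image_uminus_eq_vimage measurable_cong_sets[OF sets_symmetrization[OF sets] refl])
      also have "\<dots> = emeasure (symmetrization \<nu>) B"
        using B image_uminus_borel[OF B] by (simp add: emeasure_symmetrization[OF sets] image_image add.commute)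
      finally show "emeasure (distr (symmetrization \<nu>) borel uminus) B
        = emeasure (symmetrization \<nu>) B" .
    qed simp
  qed (use K in auto)
qed

section \<open>Cauchy transforms\<close>

text \<open>Differentiation under the integral sign, general enough for both uses: the Cauchy
  transform (\<open>n = b = 1\<close>, \<open>c = - t\<close>) and its expansion at infinity
  (\<open>n = t\<^sup>2\<close>, \<open>b = - t\<close>, \<open>c = 1\<close>). The Taylor remainder
  of the integrand is uniformly of second order.\<close>

lemma (in finite_measure)
  fixes n b c :: "'a \<Rightarrow> complex"
  assumes [measurable]: "n \<in> borel_measurable M" "b \<in> borel_measurable M" "c \<in> borel_measurable M"
    and n: "AE t in M. norm (n t) \<le> N" and b: "AE t in M. norm (b t) \<le> B" "B > 0"
    and d: "d > 0" "AE t in M. d \<le> norm (c t + w * b t)"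
  shows integrable_fraction: "integrable M (\<lambda>t. n t / (c t + w * b t))"
    and has_field_derivative_integral_fraction: "((\<lambda>w. \<integral>t. n t / (c t + w * b t) \<partial>M)
      has_field_derivative - (\<integral>t. n t * b t / (c t + w * b t)\<^sup>2 \<partial>M)) (at w)"
proof -
  have int: "integrable M (\<lambda>t. n t / (c t + w * b t))"
    if d: "d > 0" "AE t in M. d \<le> norm (c t + w * b t)" for w d
    using n d(2)
    by (intro integrable_const_bound[where B = "N / d"])
      (use d(1) in \<open>auto elim!: eventually_elim2 simp: norm_divide intro!: frac_le order.trans[OF norm_ge_zero]\<close>)
  show *: "integrable M (\<lambda>t. n t / (c t + w * b t))" by (rule int[OF d])
  have intD: "integrable M (\<lambda>t. n t * b t / (c t + w * b t)\<^sup>2)"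
  proof (rule integrable_const_bound[where B = "N * B / d\<^sup>2"])
    show "AE t in M. norm (n t * b t / (c t + w * b t)\<^sup>2) \<le> N * B / d\<^sup>2"
      using n b(1) d(2)
    proof eventually_elim
      case (elim t)
      then have "norm (n t) * norm (b t) \<le> N * B" "d\<^sup>2 \<le> (norm (c t + w * b t))\<^sup>2"
        using d(1) by (auto intro!: mult_mono power_mono order.trans[OF norm_ge_zero])
      then show ?case using d(1) b(2) order.trans[OF norm_ge_zero elim(1)]
        by (auto simp: norm_divide norm_mult norm_power intro!: frac_le)
    qed
  qed simp
  let ?f = "\<lambda>w. \<integral>t. n t / (c t + w * b t) \<partial>M"
  let ?D = "- (\<integral>t. n t * b t / (c t + w * b t)\<^sup>2 \<partial>M)"
  \<comment> \<open>The remainder below is at most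
    \<open>N * B\<^sup>2 / (d\<^sup>2 * (d / 2))\<close> times the square of the increment.\<close>
  define C where "C = N * B\<^sup>2 * 2 / d ^ 3"
  have bound: "norm ((?f y - ?f w) / (y - w) - ?D) \<le> C * measure M (space M) * norm (y - w)"
    if y: "y \<noteq> w" "norm (y - w) < d / (2 * B)" for y
  proof -
    let ?h = "y - w"
    \<comment> \<open>The radius \<open>d / (2 * B)\<close> is chosen so that the denominator moves
      by less than \<open>d / 2\<close> and stays above \<open>d / 2\<close>.\<close>
    have hB: "norm ?h * B < d / 2" using y(2) b(2) by (simp add: field_simps)
    have AEy: "AE t in M. d / 2 \<le> norm (c t + y * b t)"
      using b(1) d(2)
    proof eventually_elim
      case (elim t)
      have "norm (c t + w * b t) \<le> norm (c t + y * b t) + norm (?h * b t)"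
        using norm_triangle_ineq4[of "c t + y * b t" "?h * b t"] by (simp add: algebra_simps)
      moreover have "norm (?h * b t) \<le> norm ?h * B"
        using elim by (auto simp: norm_mult intro!: mult_left_mono)
      ultimately show ?case using elim hB by linarith
    qed
    note inty = int[OF _ AEy]
    let ?R = "\<lambda>t. n t / (c t + y * b t) - n t / (c t + w * b t) + ?h * (n t * b t / (c t + w * b t)\<^sup>2)"
    have AER: "AE t in M. norm (?R t) \<le> C * (norm ?h)\<^sup>2"
      using n b(1) d(2) AEy
    proof eventually_elim
      case (elim t)
      define u where "u = c t + w * b t"
      have yu: "c t + y * b t = u + ?h * b t" by (simp add: u_def algebra_simps)
      have nz: "u \<noteq> 0" "u + ?h * b t \<noteq> 0" using elim d(1) yu u_def by auto
      have "?R t = ?h\<^sup>2 * (n t * (b t)\<^sup>2) / (u\<^sup>2 * (u + ?h * b t))"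
        unfolding yu u_def[symmetric] using nz by (simp add: divide_simps power2_eq_square) algebra
      moreover have "norm (?h\<^sup>2 * (n t * (b t)\<^sup>2)) \<le> (norm ?h)\<^sup>2 * (N * B\<^sup>2)"
        using elim order.trans[OF norm_ge_zero elim(1)] unfolding norm_mult norm_power
        by (intro mult_mono power_mono) auto
      moreover have "d\<^sup>2 * (d / 2) \<le> norm (u\<^sup>2 * (u + ?h * b t))"
        using elim d(1) unfolding norm_mult norm_power u_def[symmetric] yu
        by (intro mult_mono power_mono) auto
      ultimately have "norm (?R t) \<le> (norm ?h)\<^sup>2 * (N * B\<^sup>2) / (d\<^sup>2 * (d / 2))"
        using d(1) order.trans[OF norm_ge_zero elim(1)] by (simp only: norm_divide) (intro frac_le, auto)
      then show ?case using d(1) by (simp add: C_def field_simps power3_eq_cube power2_eq_square)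
    qed
    have "(\<integral>t. ?R t \<partial>M) = ?f y - ?f w - ?D * ?h"
      using inty d(1) * intD by (simp del: times_divide_eq_right)
    moreover have "norm (\<integral>t. ?R t \<partial>M) \<le> (\<integral>t. C * (norm ?h)\<^sup>2 \<partial>M)"
      using AER inty d(1) * intD
      by (intro order.trans[OF integral_norm_bound integral_mono_AE]) (auto simp del: times_divide_eq_right)
    ultimately have "norm (?f y - ?f w - ?D * ?h) \<le> C * measure M (space M) * norm ?h * norm ?h"
      by (simp add: power2_eq_square mult_ac)
    moreover have "(?f y - ?f w) / ?h - ?D = (?f y - ?f w - ?D * ?h) / ?h"
      using y by (simp add: field_simps)
    ultimately show ?thesis using y by (simp add: norm_divide pos_divide_le_eq)
  qed
  show "(?f has_field_derivative ?D) (at w)"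
    unfolding has_field_derivative_iff
  proof (rule LIM_zero_cancel, rule Lim_null_comparison)
    show "\<forall>\<^sub>F y in at w. norm ((?f y - ?f w) / (y - w) - ?D) \<le> C * measure M (space M) * norm (y - w)"
      using bound b(2) d(1) unfolding eventually_at dist_norm
      by (intro exI[of _ "d / (2 * B)"]) auto
    show "((\<lambda>y. C * measure M (space M) * norm (y - w)) \<longlongrightarrow> 0) (at w)"
      by (auto intro!: tendsto_eq_intros)
  qed
qed

section \<open>Cauchy transforms of probability measures on the line\<close>

context real_distribution
begin

lemma prob_UNIV: "prob UNIV = 1"
  using prob_space by simp

text \<open>The distance bound is required only almost everywhere, so that it covers points of the
  upper half-plane as well as real points in a gap of the support.\<close>

lemma
  assumes "d > 0" "AE t in M. d \<le> norm (w - complex_of_real t)"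
  shows integrable_cauchy_transform: "integrable M (\<lambda>t. 1 / (w - complex_of_real t))"
    and has_field_derivative_cauchy_transform: "(cauchy_transform M has_field_derivative
      - (\<integral>t. 1 / (w - complex_of_real t)\<^sup>2 \<partial>M)) (at w)"
  using integrable_fraction[of "\<lambda>_. 1" "\<lambda>_. 1" "\<lambda>t. - complex_of_real t" 1 1 d w]
    has_field_derivative_integral_fraction[of "\<lambda>_. 1" "\<lambda>_. 1" "\<lambda>t. - complex_of_real t" 1 1 d w] assms
  by (auto simp: cauchy_transform_def[abs_def])

lemma cauchy_transform_cnj: "cauchy_transform M (cnj w) = cnj (cauchy_transform M w)"
  unfolding cauchy_transform_def by (subst Bochner_Integration.integral_cnj[symmetric]) simp

lemma AE_Im_le_norm: "AE t in M. Im w \<le> norm (w - complex_of_real t)"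
proof (rule AE_I2)
  fix t show "Im w \<le> norm (w - complex_of_real t)"
    using abs_Im_le_cmod[of "w - complex_of_real t"] by simp
qed

text \<open>Everything follows from \<open>Im (1 / (w - t)) = - Im w / |w - t|\<^sup>2\<close>; the
  integral on the right is nonzero because its integrand is positive everywhere.\<close>

lemma
  assumes "Im w > 0"
  shows integrable_inverse_norm_square: "integrable M (\<lambda>t. 1 / (norm (w - complex_of_real t))\<^sup>2)"
    and Im_cauchy_transform:
      "Im (cauchy_transform M w) = - Im w * (\<integral>t. 1 / (norm (w - complex_of_real t))\<^sup>2 \<partial>M)"
    and Im_cauchy_transform_neg: "Im (cauchy_transform M w) < 0"
proof -
  have le: "Im w \<le> norm (w - complex_of_real t)" for t
    using abs_Im_le_cmod[of "w - complex_of_real t"] by simp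
  show int: "integrable M (\<lambda>t. 1 / (norm (w - complex_of_real t))\<^sup>2)"
    using assms le
    by (intro integrable_const_bound[where B = "1 / (Im w)\<^sup>2"])
      (auto intro!: frac_le power_mono)
  have *: "Im (1 / (w - complex_of_real t)) = - Im w * (1 / (norm (w - complex_of_real t))\<^sup>2)" for t
    by (simp add: Im_divide cmod_power2)
  have "Im (cauchy_transform M w) = (\<integral>t. Im (1 / (w - complex_of_real t)) \<partial>M)"
    unfolding cauchy_transform_def
    using integrable_cauchy_transform[OF assms AE_Im_le_norm] by simp
  then show eq: "Im (cauchy_transform M w) = - Im w * (\<integral>t. 1 / (norm (w - complex_of_real t))\<^sup>2 \<partial>M)"
    by (simp only: * integral_mult_right_zero)
  have "0 < (\<integral>t. 1 / (norm (w - complex_of_real t))\<^sup>2 \<partial>M)"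
  proof -
    have pos: "1 / (norm (w - complex_of_real t))\<^sup>2 > 0" for t
      using less_le_trans[OF assms le[of t]] by simp
    have "(\<integral>t. 1 / (norm (w - complex_of_real t))\<^sup>2 \<partial>M) \<noteq> 0"
    proof
      assume "(\<integral>t. 1 / (norm (w - complex_of_real t))\<^sup>2 \<partial>M) = 0"
      then have "AE t in M. 1 / (norm (w - complex_of_real t))\<^sup>2 = 0"
        using int by (subst (asm) integral_nonneg_eq_0_iff_AE) auto
      then have "AE t in M. False" by eventually_elim (use pos in \<open>metis less_irrefl\<close>)
      then show False by (simp add: AE_False)
    qed
    moreover have "0 \<le> (\<integral>t. 1 / (norm (w - complex_of_real t))\<^sup>2 \<partial>M)"
      by (rule Bochner_Integration.integral_nonneg) simp
    ultimately show ?thesis by linarith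
  qed
  then show "Im (cauchy_transform M w) < 0" using eq assms by simp
qed

end

section \<open>Symmetric laws near infinity\<close>

context symmetric_law
begin

lemma integral_uminus:
  fixes f :: "real \<Rightarrow> complex"
  assumes [measurable]: "f \<in> borel_measurable borel"
  shows "(\<integral>t. f (- t) \<partial>\<nu>) = (\<integral>t. f t \<partial>\<nu>)"
proof -
  have "(\<integral>t. f t \<partial>\<nu>) = (\<integral>t. f t \<partial>distr \<nu> borel uminus)" by (simp add: symmetric)
  also have "\<dots> = (\<integral>t. f (- t) \<partial>\<nu>)" by (rule integral_distr) auto
  finally show ?thesis by simp
qed

text \<open>With \<open>s = 1 / w\<close>, expanding \<open>1 / (w - t) = s + s\<^sup>2 t + s\<^sup>3 t\<^sup>2 / (1 - s t)\<close> and using that the mean is zero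
  gives \<open>G(w) = P(s)\<close> and \<open>1 / G(w) = w + H(s)\<close>.\<close>

definition Q :: "complex \<Rightarrow> complex" where
  "Q s = (\<integral>t. (complex_of_real t)\<^sup>2 / (1 - s * complex_of_real t) \<partial>\<nu>)"

definition P :: "complex \<Rightarrow> complex" where "P s = s * (1 + s\<^sup>2 * Q s)"

definition H :: "complex \<Rightarrow> complex" where "H s = - s * Q s / (1 + s\<^sup>2 * Q s)"

definition m2 :: real where "m2 = (\<integral>t. t\<^sup>2 \<partial>\<nu>)"

lemma integrable_square: "integrable \<nu> (\<lambda>t. t\<^sup>2)"
  using bounded by (intro integrable_const_bound[where B = "K\<^sup>2"])
    (auto elim!: eventually_mono simp: abs_le_square_iff[symmetric])

lemma Q_0: "Q 0 = complex_of_real m2"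
  unfolding Q_def m2_def by (simp flip: of_real_power)

lemma m2_nonneg: "m2 \<ge> 0" unfolding m2_def by simp

lemma AE_norm_ge: "norm s < 1 / K \<Longrightarrow> AE t in \<nu>. 1 - norm s * K \<le> norm (1 - s * complex_of_real t)"
  using bounded
proof eventually_elim
  case (elim t)
  have "norm (s * complex_of_real t) \<le> norm s * K"
    using elim by (auto simp: norm_mult intro!: mult_left_mono)
  then show ?case using norm_triangle_ineq2[of 1 "s * complex_of_real t"] by simp
qed

lemma
  assumes "norm s < 1 / K"
  shows integrable_Q: "integrable \<nu> (\<lambda>t. (complex_of_real t)\<^sup>2 / (1 - s * complex_of_real t))"
    and Q_differentiable: "Q field_differentiable (at s)"
proof -
  have 1: "0 < 1 - norm s * K" using assms K_pos by (simp add: field_simps)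
  have 2: "AE t in \<nu>. norm ((complex_of_real t)\<^sup>2) \<le> K\<^sup>2"
    using bounded K_pos by (auto elim!: eventually_mono simp: norm_power abs_le_square_iff[symmetric])
  have 3: "AE t in \<nu>. norm (- complex_of_real t) \<le> K" using bounded by simp
  have 4: "AE t in \<nu>. 1 - norm s * K \<le> norm (1 + s * - complex_of_real t)"
    using AE_norm_ge[OF assms] by simp
  show "integrable \<nu> (\<lambda>t. (complex_of_real t)\<^sup>2 / (1 - s * complex_of_real t))"
    using integrable_fraction[OF _ _ _ 2 3 K_pos 1 4] by simp
  show "Q field_differentiable (at s)"
    using has_field_derivative_integral_fraction[OF _ _ _ 2 3 K_pos 1 4]
    unfolding Q_def[abs_def] field_differentiable_def by auto
qed

lemma Q_holomorphic: "Q holomorphic_on ball 0 (1 / K)"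
  unfolding holomorphic_on_def
  by (auto intro!: Q_differentiable[THEN field_differentiable_at_within])

lemma Q_cnj: "Q (cnj s) = cnj (Q s)"
  unfolding Q_def by (subst Bochner_Integration.integral_cnj[symmetric]) simp

lemma Q_uminus: "Q (- s) = Q s"
  unfolding Q_def using integral_uminus[of "\<lambda>t. (complex_of_real t)\<^sup>2 / (1 - s * complex_of_real t)"]
  by simp

lemma P_cnj: "P (cnj s) = cnj (P s)" and P_uminus: "P (- s) = - P s"
  and H_cnj: "H (cnj s) = cnj (H s)" and H_uminus: "H (- s) = - H s"
  by (simp_all add: P_def H_def Q_cnj Q_uminus)

lemma cauchy_transform_inverse:
  assumes "s \<noteq> 0" "norm s < 1 / K"
  shows "cauchy_transform \<nu> (1 / s) = P s"
proof -
  have int: "integrable \<nu> (\<lambda>t. complex_of_real t)"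
    using bounded by (intro integrable_const_bound[where B = K]) auto
  have mean: "(\<integral>t. complex_of_real t \<partial>\<nu>) = 0"
    using integral_uminus[of complex_of_real] by simp
  have "cauchy_transform \<nu> (1 / s) = (\<integral>t. s + s\<^sup>2 * complex_of_real t
      + s ^ 3 * ((complex_of_real t)\<^sup>2 / (1 - s * complex_of_real t)) \<partial>\<nu>)"
    unfolding cauchy_transform_def
  proof (rule integral_cong_AE)
    have "0 < 1 - norm s * K" using assms K_pos by (simp add: field_simps)
    with AE_norm_ge[OF assms(2)] have "AE t in \<nu>. 1 - s * complex_of_real t \<noteq> 0"
      by (auto elim!: eventually_mono)
    then show "AE t in \<nu>. 1 / (1 / s - complex_of_real t) = s + s\<^sup>2 * complex_of_real t
      + s ^ 3 * ((complex_of_real t)\<^sup>2 / (1 - s * complex_of_real t))"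
    proof eventually_elim
      case (elim t)
      have "1 / s - complex_of_real t = (1 - s * complex_of_real t) / s"
        using assms by (simp add: field_simps)
      then show ?case using elim assms
        by (simp add: divide_simps) (simp add: power2_eq_square power3_eq_cube algebra_simps)
    qed
  qed auto
  also have "\<dots> = P s"
    using int mean integrable_Q[OF assms(2)]
    by (simp add: P_def Q_def[symmetric] prob_UNIV del: times_divide_eq_right)
      (simp add: algebra_simps power2_eq_square power3_eq_cube)
  finally show ?thesis .
qed

lemma inverse_P: "s \<noteq> 0 \<Longrightarrow> 1 + s\<^sup>2 * Q s \<noteq> 0 \<Longrightarrow> 1 / P s = 1 / s + H s"
  unfolding P_def H_def by (simp add: field_simps power2_eq_square)

lemma H_0 [simp]: "H 0 = 0" and P_0 [simp]: "P 0 = 0"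
  by (simp_all add: H_def P_def)

text \<open>The second moment enters here: \<open>Q 0 = m2\<close>, so to first order
  \<open>P s\<close> is \<open>s\<close> and \<open>H s\<close> is \<open>- m2 * s\<close>.\<close>

lemma
  shows P_derivative: "(P has_field_derivative 1) (at 0)"
    and H_derivative: "(H has_field_derivative - complex_of_real m2) (at 0)"
proof -
  obtain q where q: "(Q has_field_derivative q) (at 0)"
    using Q_differentiable[of 0] K_pos by (auto simp: field_differentiable_def)
  show "(P has_field_derivative 1) (at 0)"
    unfolding P_def[abs_def] by (rule derivative_eq_intros q | simp)+
  show "(H has_field_derivative - complex_of_real m2) (at 0)"
    unfolding H_def[abs_def] by (rule derivative_eq_intros q | simp add: Q_0)+
qed

text \<open>As \<open>P\<close> has derivative 1 at 0, it is injective on a small disc. In the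
  variable \<open>w = 1 / s\<close> this disc is a neighbourhood of infinity on which the Cauchy
  transform can be inverted.\<close>

lemma disc_at_infinity:
  obtains r where "r > 0" "r \<le> 1 / K" "\<And>s::complex. norm s < r \<Longrightarrow> 1 + s\<^sup>2 * Q s \<noteq> 0"
    "P holomorphic_on ball 0 r" "H holomorphic_on ball 0 r" "inj_on P (ball 0 r)"
proof -
  have K: "1 / K > 0" using K_pos by simp
  have PK: "P holomorphic_on ball 0 (1 / K)"
    unfolding P_def[abs_def] by (intro holomorphic_intros Q_holomorphic)
  obtain r1 where r1: "r1 > 0" "inj_on P (ball 0 r1)"
    using has_complex_derivative_locally_injective[OF PK, of 0] K DERIV_imp_deriv[OF P_derivative] by auto
  have "isCont (\<lambda>s. 1 + s\<^sup>2 * Q s) 0"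
    using Q_differentiable[of 0, THEN field_differentiable_imp_continuous_at] K by (auto intro!: continuous_intros)
  then have "\<forall>\<^sub>F s in nhds 0. 1 + s\<^sup>2 * Q s \<noteq> 0"
    by (intro tendsto_imp_eventually_ne[of _ 1]) (auto simp: isCont_def filterlim_at tendsto_nhds_iff)
  then obtain r2 where r2: "r2 > 0" "\<And>s. norm s < r2 \<Longrightarrow> 1 + s\<^sup>2 * Q s \<noteq> 0"
    by (auto simp: eventually_nhds_metric)
  define r where "r = Min {r1, r2, 1 / K}"
  have r: "r > 0" "r \<le> r1" "r \<le> r2" "r \<le> 1 / K" using r1 r2 K by (auto simp: r_def)
  have Qr: "Q holomorphic_on ball 0 r"
    using Q_holomorphic r by (rule_tac holomorphic_on_subset) auto
  show thesis
  proof
    show "P holomorphic_on ball 0 r" using PK r by (rule_tac holomorphic_on_subset) auto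
    show "H holomorphic_on ball 0 r"
      unfolding H_def[abs_def] using r2 r by (intro holomorphic_intros Qr) auto
    show "inj_on P (ball 0 r)" using r1(2) r by (rule_tac inj_on_subset) auto
    show "1 + s\<^sup>2 * Q s \<noteq> 0" if "norm s < r" for s using r(3) that by (intro r2(2)) linarith
  qed (fact r(1), fact r(4))
qed

end

text \<open>For \<open>c > 0\<close> the left side is the tangent of \<open>1 / x\<close> at
  \<open>x = 1 / c\<close>. Integrating it gives the needed cases of Jensen's inequality.\<close>

lemma two_mult_minus_square_le_inverse:
  fixes c x :: real
  assumes "x > 0"
  shows "2 * c - c\<^sup>2 * x \<le> 1 / x"
proof -
  have "1 / x - (2 * c - c\<^sup>2 * x) = (1 - c * x)\<^sup>2 / x"
    using assms by (simp add: field_simps power2_eq_square)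
  then show ?thesis using assms by (metis diff_ge_0_iff_ge divide_nonneg_pos zero_le_power2)
qed

context symmetric_law
begin

text \<open>\<open>2 Re (H s)\<close> is the difference of the values of \<open>H\<close> at \<open>s\<close> and at its mirror image \<open>- cnj s\<close>.\<close>

lemma Re_H_bound:
  obtains r B where "r > 0" "r \<le> 1 / K" "B > 0" "\<And>s::complex. norm s < r \<Longrightarrow> 1 + s\<^sup>2 * Q s \<noteq> 0"
    "\<And>s. norm s < r \<Longrightarrow> \<bar>Re (H s)\<bar> \<le> B * \<bar>Re s\<bar>"
proof -
  obtain r where r: "r > 0" "r \<le> 1 / K" "\<And>s::complex. norm s < r \<Longrightarrow> 1 + s\<^sup>2 * Q s \<noteq> 0"
    and hol: "H holomorphic_on ball 0 r"
    by (metis disc_at_infinity)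
  have "compact (deriv H ` cball 0 (r / 2))"
    using r by (intro compact_continuous_image holomorphic_on_imp_continuous_on
        holomorphic_on_subset[OF holomorphic_deriv[OF hol]]) auto
  then obtain B where B: "B > 0" "\<And>s. s \<in> cball 0 (r / 2) \<Longrightarrow> norm (deriv H s) \<le> B"
    using compact_imp_bounded bounded_pos by (metis imageI)
  show thesis
  proof (rule that[of "r / 2" B])
    fix s :: complex assume s: "norm s < r / 2"
    have "norm (H s - H (- cnj s)) \<le> B * norm (s - (- cnj s))"
    proof (rule field_differentiable_bound[where S = "cball 0 (r / 2)"])
      fix w assume "w \<in> cball (0::complex) (r / 2)"
      then show "(H has_field_derivative deriv H w) (at w within cball 0 (r / 2))"
        using r by (intro holomorphic_derivI[OF hol]) auto
    qed (use B s in auto)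
    moreover have "H s - H (- cnj s) = of_real (2 * Re (H s))"
      by (simp only: H_cnj H_uminus diff_minus_eq_add complex_add_cnj)
    moreover have "s - (- cnj s) = of_real (2 * Re s)"
      by (simp only: diff_minus_eq_add complex_add_cnj)
    ultimately have "\<bar>2 * Re (H s)\<bar> \<le> B * \<bar>2 * Re s\<bar>" by (simp only: norm_of_real)
    then show "\<bar>Re (H s)\<bar> \<le> B * \<bar>Re s\<bar>" by (simp add: abs_mult)
    show "1 + s\<^sup>2 * Q s \<noteq> 0" using r(1) s by (intro r(3)) linarith
  next
    show "r / 2 \<le> 1 / K" using r(1,2) by linarith
  qed (use r(1) B(1) in auto)
qed

text \<open>Jensen's inequality for \<open>1 / x\<close> and the random variable
  \<open>v\<^sup>2 + t\<^sup>2\<close>, whose mean is \<open>v\<^sup>2 + m2\<close>.\<close>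

lemma neg_Im_cauchy_transform_ge:
  assumes "v > 0"
  shows "v / (v\<^sup>2 + m2) \<le> - Im (cauchy_transform \<nu> (\<i> * complex_of_real v))"
proof -
  have norm: "(norm (\<i> * complex_of_real v - complex_of_real t))\<^sup>2 = v\<^sup>2 + t\<^sup>2" for t
    by (simp add: cmod_power2)
  note int = integrable_inverse_norm_square[of "\<i> * complex_of_real v", unfolded norm]
  \<comment> \<open>With \<open>c\<close> the reciprocal of the mean, the tangent bound is
    optimal.\<close>
  define c where "c = 1 / (v\<^sup>2 + m2)"
  have pos: "v\<^sup>2 + m2 > 0" using assms m2_nonneg by (simp add: add_pos_nonneg)
  have "c = 2 * c - c\<^sup>2 * (v\<^sup>2 + m2)"
    using pos by (simp add: c_def power2_eq_square)
  also have "\<dots> = (\<integral>t. 2 * c - c\<^sup>2 * (v\<^sup>2 + t\<^sup>2) \<partial>\<nu>)"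
    by (simp add: integrable_square m2_def[symmetric] prob_UNIV)
  also have "\<dots> \<le> (\<integral>t. 1 / (v\<^sup>2 + t\<^sup>2) \<partial>\<nu>)"
  proof (rule integral_mono)
    fix t
    show "2 * c - c\<^sup>2 * (v\<^sup>2 + t\<^sup>2) \<le> 1 / (v\<^sup>2 + t\<^sup>2)"
      using assms by (intro two_mult_minus_square_le_inverse) (simp add: add_pos_nonneg)
  qed (use int assms integrable_square in auto)
  finally have "v * c \<le> v * (\<integral>t. 1 / (v\<^sup>2 + t\<^sup>2) \<partial>\<nu>)" using assms by simp
  then show ?thesis using Im_cauchy_transform[of "\<i> * complex_of_real v", unfolded norm] assms
    by (simp add: c_def)
qed

lemma m2_pos:
  assumes "emeasure \<nu> (- {0}) \<noteq> 0"
  shows "m2 > 0"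
proof (rule ccontr)
  assume "\<not> m2 > 0"
  then have "(\<integral>t. t\<^sup>2 \<partial>\<nu>) = 0" using m2_nonneg unfolding m2_def by linarith
  then have "AE t in \<nu>. t\<^sup>2 = 0"
    using integrable_square by (subst (asm) integral_nonneg_eq_0_iff_AE) auto
  then have "AE t in \<nu>. t = 0" by simp
  then have "emeasure \<nu> (- {0}) = 0"
    by (subst (asm) AE_iff_measurable[where N = "- {0}"]) auto
  then show False using assms by simp
qed

lemma moment_2_eq: "moment_2 \<nu> = ennreal m2"
  unfolding moment_2_def m2_def by (rule nn_integral_eq_integral) (auto intro: integrable_square)

text \<open>The tangent bound integrated in \<open>ennreal\<close>, so that an infinite moment is
  covered too. The best choice of \<open>c\<close> would give \<open>1 / m2\<close>.\<close>

lemma moment_minus_2_ge: "ennreal (2 * c - c\<^sup>2 * m2) \<le> moment_minus_2 \<nu>"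
proof -
  have "2 * c - c\<^sup>2 * m2 = (\<integral>t. 2 * c - c\<^sup>2 * t\<^sup>2 \<partial>\<nu>)"
    using integrable_square by (simp add: m2_def prob_UNIV)
  \<comment> \<open>The tangent becomes negative for large \<open>t\<close>; its positive part is
    what the nonnegative integral can compare.\<close>
  also have "\<dots> \<le> (\<integral>t. max 0 (2 * c - c\<^sup>2 * t\<^sup>2) \<partial>\<nu>)"
    using integrable_square by (intro integral_mono) auto
  also have "ennreal \<dots> = (\<integral>\<^sup>+t. ennreal (max 0 (2 * c - c\<^sup>2 * t\<^sup>2)) \<partial>\<nu>)"
    using integrable_square by (intro nn_integral_eq_integral[symmetric]) auto
  also have "\<dots> \<le> moment_minus_2 \<nu>"
    unfolding moment_minus_2_def
  proof (rule nn_integral_mono)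
    fix t :: real
    show "ennreal (max 0 (2 * c - c\<^sup>2 * t\<^sup>2)) \<le> inverse (ennreal (t\<^sup>2))"
    proof (cases "t = 0")
      case False
      then have p: "t\<^sup>2 > 0" by simp
      have "2 * c - c\<^sup>2 * t\<^sup>2 \<le> inverse (t\<^sup>2)"
        using two_mult_minus_square_le_inverse[OF p] by (simp add: inverse_eq_divide)
      then show ?thesis using p by (simp add: inverse_ennreal ennreal_leI)
    qed auto
  qed
  finally show ?thesis by (simp add: ennreal_leI)
qed

end

section \<open>Reflection in the imaginary axis, and limits in the compactified half-plane\<close>

lemma vertical_reflection:
  assumes f: "f holomorphic_on S" and S: "open S" "connected S" "\<And>w. w \<in> S \<Longrightarrow> - cnj w \<in> S"
    and y0: "\<i> * complex_of_real y0 \<in> S" "e > 0"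
    and zero: "\<And>y. \<bar>y - y0\<bar> < e \<Longrightarrow> \<i> * complex_of_real y \<in> S \<Longrightarrow> Re (f (\<i> * complex_of_real y)) = 0"
    and "w \<in> S"
  shows "f (- cnj w) = - cnj (f w)"
proof -
  have "(f \<circ> uminus) holomorphic_on cnj ` S"
    using S by (intro holomorphic_on_compose_gen[OF _ f] holomorphic_intros) auto
  \<comment> \<open>The function \<open>f w + cnj (f (- cnj w))\<close> is holomorphic and equals
    \<open>2 * Re (f w)\<close> on the imaginary axis, so it vanishes on a segment and hence on all
    of \<open>S\<close>.\<close>
  then have hol: "(\<lambda>w. f w + (cnj \<circ> (f \<circ> uminus) \<circ> cnj) w) holomorphic_on S"
    using S by (intro holomorphic_on_add f holomorphic_on_compose_cnj_cnj)
  let ?U = "S \<inter> (\<lambda>y. \<i> * complex_of_real y) ` {y0 - e<..<y0 + e}"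
  have lim: "(\<i> * complex_of_real y0) islimpt ?U"
    unfolding islimpt_approachable
  proof (intro allI impI)
    fix d :: real assume d: "d > 0"
    obtain d' where d': "d' > 0" "ball (\<i> * complex_of_real y0) d' \<subseteq> S"
      using S(1) y0(1) open_contains_ball by blast
    define h where "h = min d (min d' e) / 2"
    have h: "0 < h" "h < d" "h < d'" "h < e" using d d'(1) y0(2) by (auto simp: h_def min_def)
    have dist: "dist (\<i> * complex_of_real (y0 + h)) (\<i> * complex_of_real y0) = h"
      using h by (simp add: dist_norm ring_distribs norm_mult)
    then have "\<i> * complex_of_real (y0 + h) \<in> S" using d'(2) h by (auto simp: dist_commute)
    then show "\<exists>x'\<in>?U. x' \<noteq> \<i> * complex_of_real y0 \<and> dist x' (\<i> * complex_of_real y0) < d"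
      using dist h by (intro bexI[of _ "\<i> * complex_of_real (y0 + h)"] IntI imageI) auto
  qed
  have "f w + (cnj \<circ> (f \<circ> uminus) \<circ> cnj) w = 0"
  proof (rule analytic_continuation[OF hol S(1,2) _ y0(1) lim])
    fix z assume "z \<in> ?U"
    then obtain y where "z = \<i> * complex_of_real y" "Re (f z) = 0" using zero by auto
    then show "f z + (cnj \<circ> (f \<circ> uminus) \<circ> cnj) z = 0" by (simp add: complex_add_cnj)
  qed (use \<open>w \<in> S\<close> in auto)
  then have "cnj (f w) = - f (- cnj w)"
    by (metis (no_types, lifting) comp_apply complex_cnj_cnj complex_cnj_minus eq_neg_iff_add_eq_0)
  then show ?thesis by simp
qed

lemma Alexandroff_compactification_tendsto_Some:
  assumes cont: "continuous_map (top_of_set S) (Alexandroff_compactification (top_of_set S')) \<omega>"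
    and "w0 \<in> S" "\<omega> w0 = Some c"
  shows "((\<lambda>w. the (\<omega> w)) \<longlongrightarrow> c) (at w0 within S)"
proof (rule topological_tendstoI)
  fix U assume U: "open U" "c \<in> U"
  have "\<omega> w0 \<in> insert None (Some ` S')"
    using cont \<open>w0 \<in> S\<close> by (auto simp: continuous_map_def Pi_iff)
  then have "c \<in> S'" using assms by auto
  have "openin (top_of_set S) {w \<in> S. \<omega> w \<in> Some ` (U \<inter> S')}"
    using openin_continuous_map_preimage[OF cont, of "Some ` (U \<inter> S')"] U(1)
    by (auto simp: openin_open_Int Int_commute)
  then obtain T where T: "open T" "{w \<in> S. \<omega> w \<in> Some ` (U \<inter> S')} = S \<inter> T"
    by (auto simp: openin_open)
  have "w0 \<in> T" using T(2) U \<open>c \<in> S'\<close> assms by blast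
  moreover have "the (\<omega> w) \<in> U" if "w \<in> S" "w \<in> T" for w
  proof -
    have "\<omega> w \<in> Some ` (U \<inter> S')" using T(2) that by blast
    then show ?thesis by auto
  qed
  ultimately show "\<forall>\<^sub>F w in at w0 within S. the (\<omega> w) \<in> U"
    using T(1) unfolding eventually_at_topological by blast
qed

text \<open>The complement of a ball is a neighbourhood of infinity. The alternative
  \<open>None\<close> remains because nearby points of \<open>S\<close> may be sent to infinity as
  well.\<close>

lemma Alexandroff_compactification_tendsto_None:
  fixes \<omega> :: "'a::topological_space \<Rightarrow> complex option"
  assumes cont: "continuous_map (top_of_set S) (Alexandroff_compactification (top_of_set S')) \<omega>"
    and "closed S'" "w0 \<in> S" "\<omega> w0 = None"
  shows "\<forall>\<^sub>F w in at w0 within S. \<omega> w = None \<or> R < norm (the (\<omega> w))"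
proof -
  let ?V = "insert None (Some ` (S' - cball 0 R))"
  have "compact (cball 0 R \<inter> S')" using \<open>closed S'\<close> by (intro compact_Int_closed) auto
  then have "openin (Alexandroff_compactification (top_of_set S')) (insert None (Some ` (topspace (top_of_set S') - (cball 0 R \<inter> S'))))"
    using \<open>closed S'\<close> unfolding openin_Alexandroff_compactification
    by (intro disjI2 exI[of _ "cball 0 R \<inter> S'"]) (auto simp: compactin_subtopology closedin_closed)
  moreover have "topspace (top_of_set S') - (cball 0 R \<inter> S') = S' - cball 0 R" by auto
  ultimately have "openin (Alexandroff_compactification (top_of_set S')) ?V" by metis
  from openin_continuous_map_preimage[OF cont this]
  obtain T where T: "open T" "{w \<in> S. \<omega> w \<in> ?V} = S \<inter> T"
    by (auto simp: openin_open)
  have "w0 \<in> T" using T(2) assms by blast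
  moreover have "\<omega> w = None \<or> R < norm (the (\<omega> w))" if "w \<in> S" "w \<in> T" for w
  proof -
    have "\<omega> w \<in> ?V" using T(2) that by blast
    then show ?thesis by auto
  qed
  ultimately show ?thesis
    using T(1) unfolding eventually_at_topological by blast
qed

lemma is_subordination_pair_commute:
  "is_subordination_pair \<mu>1 \<mu>2 \<mu> \<omega>1 \<omega>2 \<Longrightarrow> is_subordination_pair \<mu>2 \<mu>1 \<mu> \<omega>2 \<omega>1"
  unfolding is_subordination_pair_def by (auto simp: add.commute)

section \<open>Subordination functions of symmetric laws\<close>

locale subordination =
  law1: symmetric_law K1 \<mu>1 + law2: symmetric_law K2 \<mu>2 + real_distribution \<mu>
  for K1 K2 :: real and \<mu>1 \<mu>2 \<mu> :: "real measure" +
  fixes \<omega>1 \<omega>2 :: "complex \<Rightarrow> complex option" and \<epsilon> :: real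
  assumes pair: "is_subordination_pair \<mu>1 \<mu>2 \<mu> \<omega>1 \<omega>2"
    and gap: "\<epsilon> > 0" "AE t in \<mu>. \<epsilon> \<le> \<bar>t\<bar>"
begin

text \<open>The two laws play symmetric roles, so every fact about \<open>\<omega>1\<close> is
  proved once and transferred to \<open>\<omega>2\<close>.\<close>

lemma swapped: "subordination K2 K1 \<mu>2 \<mu>1 \<mu> \<omega>2 \<omega>1 \<epsilon>"
  by (intro subordination.intro subordination_axioms.intro law1.symmetric_law_axioms
      law2.symmetric_law_axioms real_distribution_axioms is_subordination_pair_commute[OF pair] gap)

definition f1 :: "complex \<Rightarrow> complex" where "f1 w = the (\<omega>1 w)"
definition f2 :: "complex \<Rightarrow> complex" where "f2 w = the (\<omega>2 w)"

lemma f2_swapped: "subordination.f1 \<omega>2 = f2"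
  by (simp add: fun_eq_iff f2_def subordination.f1_def[OF swapped])

lemma f1_swapped: "subordination.f2 \<omega>1 = f1"
  by (simp add: fun_eq_iff f1_def subordination.f2_def[OF swapped])

abbreviation G :: "complex \<Rightarrow> complex" where "G \<equiv> cauchy_transform \<mu>"

lemma continuous:
  "continuous_map (top_of_set closed_upper_half_plane)
     (Alexandroff_compactification (top_of_set closed_upper_half_plane)) \<omega>1"
  using pair by (simp add: is_subordination_pair_def)

lemma \<omega>1_values: "w \<in> closed_upper_half_plane \<Longrightarrow> \<omega>1 w = Some c \<Longrightarrow> Im c \<ge> 0"
  using continuous by (auto simp: continuous_map_def Pi_iff closed_upper_half_plane_def)

lemma closed_uhp: "closed closed_upper_half_plane"
  unfolding closed_upper_half_plane_def by (rule closed_halfspace_Im_ge)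

lemma
  assumes "Im w > 0"
  shows \<omega>1_eq: "\<omega>1 w = Some (f1 w)" and G_f1: "cauchy_transform \<mu>1 (f1 w) = G w"
    and f1_plus_f2: "f1 w + f2 w = w + 1 / G w"
  using pair assms by (auto simp: is_subordination_pair_def upper_half_plane_def f1_def f2_def)

lemma f1_holomorphic: "f1 holomorphic_on {w. Im w > 0}"
  using pair unfolding is_subordination_pair_def f1_def[abs_def] upper_half_plane_def
  by (auto intro: analytic_imp_holomorphic)

text \<open>Put \<open>s = 1 / \<omega>2\<close>. The expansions \<open>P\<close> and
  \<open>H\<close> of the second law turn the subordination equations into \<open>P s = G w\<close>
  and \<open>\<omega>1 = w + H s\<close>.\<close>

lemma near_infinity:
  assumes "Im w > 0" "f2 w \<noteq> 0" "norm (1 / f2 w) < 1 / K2"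
    and "1 + (1 / f2 w)\<^sup>2 * law2.Q (1 / f2 w) \<noteq> 0"
  shows "law2.P (1 / f2 w) = G w" "f1 w = w + law2.H (1 / f2 w)"
proof -
  have "cauchy_transform \<mu>2 (f2 w) = G w"
    using subordination.G_f1[OF swapped assms(1)] by (simp add: f2_swapped)
  then show P: "law2.P (1 / f2 w) = G w"
    using law2.cauchy_transform_inverse[of "1 / f2 w"] assms by simp
  have "1 / G w = f2 w + law2.H (1 / f2 w)"
    using law2.inverse_P[of "1 / f2 w"] assms P by simp
  then show "f1 w = w + law2.H (1 / f2 w)"
    using f1_plus_f2[OF assms(1)] by (simp add: algebra_simps)
qed

text \<open>Since \<open>Re (1 / f2 w) = Re (f2 w) / |f2 w|\<^sup>2\<close>, the bound on
  \<open>Re (H s)\<close> by \<open>Re s\<close> becomes a contraction for large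
  \<open>f2 w\<close>.\<close>

lemma Re_f1_le:
  obtains Y where "\<And>w. Im w > 0 \<Longrightarrow> norm (f2 w) > Y \<Longrightarrow> \<bar>Re (f1 w) - Re w\<bar> \<le> \<bar>Re (f2 w)\<bar> / 2"
proof -
  obtain r B where r: "r > 0" "r \<le> 1 / K2" "B > 0"
    and nz: "\<And>s::complex. norm s < r \<Longrightarrow> 1 + s\<^sup>2 * law2.Q s \<noteq> 0"
    and B: "\<And>s. norm s < r \<Longrightarrow> \<bar>Re (law2.H s)\<bar> \<le> B * \<bar>Re s\<bar>"
    by (metis law2.Re_H_bound)
  \<comment> \<open>\<open>1 / r\<close> brings \<open>1 / f2 w\<close> into the disc;
    \<open>1\<close> and \<open>2 * B\<close> together make \<open>B / |f2 w|\<^sup>2\<close> at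
    most one half.\<close>
  define Y where "Y = max (1 / r) (max 1 (2 * B))"
  show thesis
  proof (rule that[of Y])
    fix w assume w: "Im w > 0" "norm (f2 w) > Y"
    then have Y: "norm (f2 w) > 1 / r" "norm (f2 w) > 1" "norm (f2 w) > 2 * B" by (auto simp: Y_def)
    have "f2 w \<noteq> 0" using Y(2) by auto
    have s: "norm (1 / f2 w) < r" using Y(1) r(1) \<open>f2 w \<noteq> 0\<close> by (simp add: norm_divide field_simps)
    have "f1 w = w + law2.H (1 / f2 w)"
      using near_infinity(2)[OF w(1) \<open>f2 w \<noteq> 0\<close> _ nz[OF s]] s r(2) by linarith
    then have "\<bar>Re (f1 w) - Re w\<bar> \<le> B * \<bar>Re (1 / f2 w)\<bar>" using B[OF s] by simp
    also have "Re (1 / f2 w) = Re (f2 w) / (norm (f2 w))\<^sup>2"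
      by (simp add: Re_divide cmod_power2)
    also have "B * \<bar>Re (f2 w) / (norm (f2 w))\<^sup>2\<bar> = (B / (norm (f2 w))\<^sup>2) * \<bar>Re (f2 w)\<bar>"
      by (simp add: abs_divide)
    also have "\<dots> \<le> (1 / 2) * \<bar>Re (f2 w)\<bar>"
    proof (rule mult_right_mono)
      have "2 * B * 1 \<le> norm (f2 w) * norm (f2 w)"
        using Y r(3) by (intro mult_mono) auto
      then show "B / (norm (f2 w))\<^sup>2 \<le> 1 / 2"
        using \<open>f2 w \<noteq> 0\<close> by (simp add: field_simps power2_eq_square)
    qed simp
    finally show "\<bar>Re (f1 w) - Re w\<bar> \<le> \<bar>Re (f2 w)\<bar> / 2" by simp
  qed
qed

lemma f1_at_i_infinity: "\<forall>\<^sub>F y in at_top. Y < norm (f1 (\<i> * complex_of_real y))"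
proof -
  have "((\<lambda>y. f1 (\<i> * complex_of_real y) / (\<i> * complex_of_real y)) \<longlongrightarrow> 1) at_top"
    using pair by (simp add: is_subordination_pair_def f1_def)
  from tendsto_norm[OF this]
  have "\<forall>\<^sub>F y in at_top. norm (f1 (\<i> * complex_of_real y) / (\<i> * complex_of_real y)) > 1 / 2"
    by (rule order_tendstoD) simp
  then show ?thesis using eventually_gt_at_top[of "2 * \<bar>Y\<bar>"]
  proof eventually_elim
    case (elim y)
    then show ?case by (simp add: norm_divide norm_mult field_simps)
  qed
qed

text \<open>Near \<open>i\<infinity>\<close> the real parts of \<open>f1\<close> and \<open>f2\<close> are each at most half the other, hence zero.\<close>

lemma Re_f1_imaginary:
  assumes "y > 0"
  shows "Re (f1 (\<i> * complex_of_real y)) = 0"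
proof -
  interpret swap: subordination K2 K1 \<mu>2 \<mu>1 \<mu> \<omega>2 \<omega>1 \<epsilon> by (rule swapped)
  obtain Y1 where Y1: "\<And>w. Im w > 0 \<Longrightarrow> norm (f2 w) > Y1 \<Longrightarrow> \<bar>Re (f1 w) - Re w\<bar> \<le> \<bar>Re (f2 w)\<bar> / 2"
    using Re_f1_le by blast
  obtain Y2 where Y2: "\<And>w. Im w > 0 \<Longrightarrow> norm (f1 w) > Y2 \<Longrightarrow> \<bar>Re (f2 w) - Re w\<bar> \<le> \<bar>Re (f1 w)\<bar> / 2"
    using swap.Re_f1_le unfolding f2_swapped f1_swapped by blast
  have "\<forall>\<^sub>F y in at_top. Re (f1 (\<i> * complex_of_real y)) = 0"
    using f1_at_i_infinity[of Y2] swap.f1_at_i_infinity[of Y1, unfolded f2_swapped]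
      eventually_gt_at_top[of 0]
  proof eventually_elim
    case (elim y)
    then show ?case using Y1[of "\<i> * complex_of_real y"] Y2[of "\<i> * complex_of_real y"] by simp
  qed
  then obtain Y where Y: "\<And>y. y \<ge> Y \<Longrightarrow> Re (f1 (\<i> * complex_of_real y)) = 0"
    by (auto simp: eventually_at_top_linorder)
  \<comment> \<open>Reflection carries the vanishing from a segment far up to the whole half-axis,
    every point of which is fixed by \<open>w \<mapsto> - cnj w\<close>.\<close>
  have "f1 (- cnj (\<i> * complex_of_real y)) = - cnj (f1 (\<i> * complex_of_real y))"
  proof (rule vertical_reflection[OF f1_holomorphic, of "\<bar>Y\<bar> + 1" 1])
    show "open {w. 0 < Im w}" by (rule open_halfspace_Im_gt)
    show "connected {w. 0 < Im w}" by (intro convex_connected convex_halfspace_Im_gt)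
  qed (use assms Y in auto)
  then show ?thesis by (simp add: complex_eq_iff)
qed

lemma Re_f2_imaginary: "y > 0 \<Longrightarrow> Re (f2 (\<i> * complex_of_real y)) = 0"
  using subordination.Re_f1_imaginary[OF swapped] by (simp add: f2_swapped)

section \<open>The Cauchy transform of \<open>\<mu>\<close> and the subordination functions at
  0\<close>

lemma G_nonzero: "Im w > 0 \<Longrightarrow> G w \<noteq> 0"
  using Im_cauchy_transform_neg[of w] by auto

text \<open>On the imaginary axis \<open>1 / G w = f1 w + f2 w - w\<close> is purely
  imaginary.\<close>

lemma Re_G_imaginary:
  assumes "y > 0"
  shows "Re (G (\<i> * complex_of_real y)) = 0"
proof -
  have "Re (1 / G (\<i> * complex_of_real y)) = 0"
    using f1_plus_f2[of "\<i> * complex_of_real y"] Re_f1_imaginary[OF assms] Re_f2_imaginary[OF assms] assms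
    by (metis (no_types, lifting) Im_complex_of_real Re_complex_of_real add_cancel_left_left plus_complex.simps(1)
       Re_i_times add_0 minus_zero Im_i_times)
  then show ?thesis using G_nonzero[of "\<i> * complex_of_real y"] assms
    by (auto simp: Re_divide complex_eq_iff add_nonneg_eq_0_iff)
qed

text \<open>\<open>m\<close> is the paper's \<open>m\<^sub>-\<^sub>2(\<mu>)\<close>, finite because of the gap at \<open>0\<close>.\<close>

definition m :: real where "m = (\<integral>t. 1 / t\<^sup>2 \<partial>\<mu>)"

lemma AE_gap: "norm w < \<epsilon> \<Longrightarrow> AE t in \<mu>. \<epsilon> - norm w \<le> norm (w - complex_of_real t)"
  using gap(2)
proof eventually_elim
  case (elim t)
  then show ?case using norm_triangle_ineq2[of "complex_of_real t" w] by (simp add: norm_minus_commute)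
qed

lemma G_field_differentiable: "norm w < \<epsilon> \<Longrightarrow> G field_differentiable (at w)"
  using has_field_derivative_cauchy_transform[OF _ AE_gap] unfolding field_differentiable_def
  by fastforce

lemma G_holomorphic: "G holomorphic_on ball 0 \<epsilon>"
  unfolding holomorphic_on_def
  by (auto intro!: G_field_differentiable[THEN field_differentiable_at_within])

lemma G_derivative: "(G has_field_derivative - complex_of_real m) (at 0)"
proof -
  have "(\<integral>t. 1 / (0 - complex_of_real t)\<^sup>2 \<partial>\<mu>) = complex_of_real m"
    unfolding m_def by (subst integral_complex_of_real[symmetric]) simp
  then show ?thesis using has_field_derivative_cauchy_transform[of \<epsilon> 0] AE_gap[of 0] gap(1) by simp
qed

lemma m_pos: "m > 0"
proof -
  \<comment> \<open>Integrability comes first, because a nonintegrable function would have integral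
    0 by default.\<close>
  have int: "integrable \<mu> (\<lambda>t. 1 / t\<^sup>2)"
  proof (rule integrable_const_bound[where B = "1 / \<epsilon>\<^sup>2"])
    show "AE t in \<mu>. norm (1 / t\<^sup>2) \<le> 1 / \<epsilon>\<^sup>2"
      using gap(2)
    proof eventually_elim
      case (elim t)
      then have "\<epsilon>\<^sup>2 \<le> t\<^sup>2" using gap(1) power_mono[of \<epsilon> "\<bar>t\<bar>" 2] by simp
      then show ?case using gap(1) by (simp add: frac_le)
    qed
  qed simp
  have "m \<noteq> 0"
  proof
    assume "m = 0"
    then have "AE t in \<mu>. 1 / t\<^sup>2 = 0"
      unfolding m_def using int by (subst (asm) integral_nonneg_eq_0_iff_AE) auto
    then have "AE t in \<mu>. False" using gap(2)
    proof eventually_elim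
      case (elim t)
      then show False using gap(1) by simp
    qed
    then show False by (simp add: AE_False)
  qed
  moreover have "m \<ge> 0" unfolding m_def by (rule Bochner_Integration.integral_nonneg) simp
  ultimately show ?thesis by simp
qed

lemma vertical_limit:
  "filterlim (\<lambda>y. \<i> * complex_of_real y) (at 0 within closed_upper_half_plane) (at_right 0)"
  unfolding filterlim_at closed_upper_half_plane_def
  by (auto intro!: tendsto_eq_intros eventually_at_right_less[THEN eventually_mono] simp: eventually_conj_iff)

lemma G_limit: "((\<lambda>y. G (\<i> * complex_of_real y)) \<longlongrightarrow> G 0) (at_right 0)"
proof -
  have "isCont G 0"
    using G_field_differentiable[of 0] gap(1) field_differentiable_imp_continuous_at by auto
  then show ?thesis
    by (rule isCont_tendsto_compose) (auto intro!: tendsto_eq_intros)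
qed

text \<open>The imaginary part vanishes by conjugation symmetry, the real part as a limit along the
  imaginary axis.\<close>

lemma G_0: "G 0 = 0"
proof -
  have "Im (G 0) = 0" using cauchy_transform_cnj[of 0] by (simp add: complex_eq_iff)
  moreover have "((\<lambda>y. Re (G (\<i> * complex_of_real y))) \<longlongrightarrow> Re (G 0)) (at_right 0)"
    by (intro tendsto_intros G_limit)
  then have "((\<lambda>y. 0) \<longlongrightarrow> Re (G 0)) (at_right (0::real))"
    by (rule Lim_transform_eventually)
      (use eventually_at_right_less[of 0] in \<open>auto elim!: eventually_mono simp: Re_G_imaginary\<close>)
  then have "Re (G 0) = 0" by (simp add: tendsto_const_iff)
  ultimately show ?thesis by (simp add: complex_eq_iff)
qed

lemma f1_limit:
  assumes "\<omega>1 0 = Some c"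
  shows "((\<lambda>y. f1 (\<i> * complex_of_real y)) \<longlongrightarrow> c) (at_right 0)"
proof -
  have "(f1 \<longlongrightarrow> c) (at 0 within closed_upper_half_plane)"
    unfolding f1_def[abs_def] using assms
    by (intro Alexandroff_compactification_tendsto_Some[OF continuous]) (auto simp: closed_upper_half_plane_def)
  then show ?thesis using vertical_limit by (rule filterlim_compose)
qed

text \<open>A finite value is a limit of points of the imaginary axis. If it were in the open
  half-plane, the Cauchy transform of \<open>\<mu>1\<close> there would equal
  \<open>G 0 = 0\<close>, contrary to its negative imaginary part.\<close>

lemma \<omega>1_0:
  assumes "\<omega>1 0 = Some c"
  shows "c = 0"
proof -
  note lim = f1_limit[OF assms]
  have "((\<lambda>y. Re (f1 (\<i> * complex_of_real y))) \<longlongrightarrow> Re c) (at_right 0)"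
    by (intro tendsto_intros lim)
  then have "((\<lambda>y. 0) \<longlongrightarrow> Re c) (at_right (0::real))"
    by (rule Lim_transform_eventually)
      (use eventually_at_right_less[of 0] in \<open>auto elim!: eventually_mono simp: Re_f1_imaginary\<close>)
  then have Re: "Re c = 0" by (simp add: tendsto_const_iff)
  have "Im c \<ge> 0" using \<omega>1_values[OF _ assms] by (simp add: closed_upper_half_plane_def)
  moreover have "\<not> Im c > 0"
  proof
    assume c: "Im c > 0"
    have "isCont (cauchy_transform \<mu>1) c"
      using law1.has_field_derivative_cauchy_transform[OF c law1.AE_Im_le_norm]
      by (rule DERIV_isCont)
    then have "((\<lambda>y. cauchy_transform \<mu>1 (f1 (\<i> * complex_of_real y))) \<longlongrightarrow> cauchy_transform \<mu>1 c) (at_right 0)"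
      by (rule isCont_tendsto_compose) (rule lim)
    then have "((\<lambda>y. G (\<i> * complex_of_real y)) \<longlongrightarrow> cauchy_transform \<mu>1 c) (at_right 0)"
      by (rule Lim_transform_eventually)
        (use eventually_at_right_less[of 0] in \<open>auto elim!: eventually_mono simp: G_f1\<close>)
    then have "cauchy_transform \<mu>1 c = 0"
      using tendsto_unique[OF _ G_limit] G_0 by fastforce
    then show False using law1.Im_cauchy_transform_neg[OF c] by simp
  qed
  ultimately show ?thesis using Re by (simp add: complex_eq_iff)
qed

text \<open>If both values were 0, the identity \<open>(f1 w + f2 w - w) * G w = 1\<close> would
  become \<open>0 = 1\<close> in the limit.\<close>

lemma \<omega>_None: "\<omega>1 0 = None \<or> \<omega>2 0 = None"
proof (rule ccontr)
  assume "\<not> (\<omega>1 0 = None \<or> \<omega>2 0 = None)"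
  then have "\<omega>1 0 = Some 0" "\<omega>2 0 = Some 0"
    using \<omega>1_0 subordination.\<omega>1_0[OF swapped] by auto
  then have "((\<lambda>y. f1 (\<i> * complex_of_real y)) \<longlongrightarrow> 0) (at_right 0)"
    "((\<lambda>y. f2 (\<i> * complex_of_real y)) \<longlongrightarrow> 0) (at_right 0)"
    using f1_limit subordination.f1_limit[OF swapped] by (auto simp: f2_swapped)
  then have "((\<lambda>y. (f1 (\<i> * complex_of_real y) + f2 (\<i> * complex_of_real y) - \<i> * complex_of_real y)
       * G (\<i> * complex_of_real y)) \<longlongrightarrow> (0 + 0 - \<i> * complex_of_real 0) * G 0) (at_right 0)"
    by (intro tendsto_intros G_limit)
  then have "((\<lambda>y. 1) \<longlongrightarrow> (0 + 0 - \<i> * complex_of_real 0) * G 0) (at_right (0::real))"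
    by (rule Lim_transform_eventually)
      (use eventually_at_right_less[of 0] in \<open>auto elim!: eventually_mono simp: f1_plus_f2 G_nonzero\<close>)
  then show False by (simp add: tendsto_const_iff)
qed

end

section \<open>The point 0\<close>

text \<open>Covering by \<open>n\<close> intervals of radius \<open>r / n\<close> bounds the mass by
  \<open>n * C * (r / n)\<^sup>2\<close>, which tends to 0.\<close>

lemma (in real_distribution) emeasure_interval_eq_0:
  assumes small: "\<And>\<alpha> e. \<bar>\<alpha>\<bar> < r \<Longrightarrow> e > 0 \<Longrightarrow> prob {\<alpha> - e..\<alpha> + e} \<le> C * e\<^sup>2"
  shows "emeasure M {- r<..<r} = 0"
proof (cases "r > 0")
  case True
  have le: "prob {- r<..<r} \<le> C * r\<^sup>2 / real n" if "n > 0" for n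
  proof -
    \<comment> \<open>The centre of the \<open>i\<close>-th of \<open>n\<close> equal
      subintervals.\<close>
    define \<alpha> where "\<alpha> i = - r + (2 * real i + 1) * (r / real n)" for i
    have "{- r<..<r} \<subseteq> (\<Union>i<n. {\<alpha> i - r / real n..\<alpha> i + r / real n})"
    proof
      fix t assume t: "t \<in> {- r<..<r}"
      define x where "x = (t + r) / (2 * r) * real n"
      define i where "i = nat \<lfloor>x\<rfloor>"
      have x: "0 \<le> x" "x < real n" "t = - r + x * (2 * r / real n)"
      proof -
        have "0 \<le> (t + r) / (2 * r)" "(t + r) / (2 * r) < 1" using t True by (auto simp: field_simps)
        then show "0 \<le> x" "x < real n"
          using \<open>n > 0\<close> mult_strict_right_mono[of "(t + r) / (2 * r)" 1 "real n"]
          unfolding x_def by (auto intro: mult_nonneg_nonneg simp del: times_divide_eq_left)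
        show "t = - r + x * (2 * r / real n)" using True \<open>n > 0\<close> by (simp add: x_def)
      qed
      have i: "real i \<le> x" "x < real i + 1" using x(1) unfolding i_def by linarith+
      then have "i < n" using x(2) by linarith
      have "real i * (2 * r / real n) \<le> x * (2 * r / real n)"
        "x * (2 * r / real n) \<le> (real i + 1) * (2 * r / real n)"
        by (rule mult_right_mono; use i True in simp)+
      then have "t \<in> {\<alpha> i - r / real n..\<alpha> i + r / real n}"
        by (simp add: x(3) \<alpha>_def algebra_simps add_divide_distrib)
      then show "t \<in> (\<Union>i<n. {\<alpha> i - r / real n..\<alpha> i + r / real n})" using \<open>i < n\<close> by blast
    qed
    then have "prob {- r<..<r} \<le> prob (\<Union>i<n. {\<alpha> i - r / real n..\<alpha> i + r / real n})"
      by (intro finite_measure_mono) auto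
    also have "\<dots> \<le> (\<Sum>i<n. prob {\<alpha> i - r / real n..\<alpha> i + r / real n})"
      by (intro finite_measure_subadditive_finite) auto
    also have "\<dots> \<le> (\<Sum>i<n. C * (r / real n)\<^sup>2)"
    proof (intro sum_mono small)
      fix i assume "i \<in> {..<n}"
      then have "2 * real i + 1 < 2 * real n" by auto
      then have "(2 * real i + 1) * (r / real n) < 2 * real n * (r / real n)"
        using True \<open>n > 0\<close> by (intro mult_strict_right_mono) auto
      moreover have "(2 * real i + 1) * (r / real n) > 0" using True \<open>n > 0\<close> by simp
      ultimately show "\<bar>\<alpha> i\<bar> < r" using \<open>n > 0\<close> unfolding \<alpha>_def by simp
    qed (use True \<open>n > 0\<close> in simp)
    also have "\<dots> = C * r\<^sup>2 / real n"
      using \<open>n > 0\<close> by (simp add: power2_eq_square)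
    finally show ?thesis .
  qed
  have "(\<lambda>n. C * r\<^sup>2 / real n) \<longlonglongrightarrow> 0" by (rule lim_const_over_n)
  then have "prob {- r<..<r} \<le> 0"
    by (rule tendsto_lowerbound) (use le in \<open>auto intro!: eventually_sequentiallyI[of 1]\<close>)
  then show ?thesis by (simp add: emeasure_eq_measure measure_le_0_iff)
qed auto

lemma Im_derivative_eq_0:
  assumes "(f has_field_derivative D) (at (complex_of_real x))"
    and "\<forall>\<^sub>F y in nhds x. Im (f (complex_of_real y)) = 0"
  shows "Im D = 0"
proof -
  have "filterlim complex_of_real (at (complex_of_real x)) (at x)"
    by (auto simp: filterlim_at eventually_at_filter intro!: tendsto_eq_intros)
  with assms(1) have "((\<lambda>y. (f (complex_of_real y) - f (complex_of_real x)) / (complex_of_real y - complex_of_real x))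
      \<longlongrightarrow> D) (at x)"
    unfolding has_field_derivative_iff by (rule filterlim_compose)
  from tendsto_Im[OF this] have "((\<lambda>y. 0) \<longlongrightarrow> Im D) (at x)"
  proof (rule Lim_transform_eventually)
    have "Im (f (complex_of_real x)) = 0" using assms(2) by (rule eventually_nhds_x_imp_x)
    moreover have "\<forall>\<^sub>F y in at x. Im (f (complex_of_real y)) = 0"
      using assms(2) by (simp add: eventually_at_filter eventually_mono)
    ultimately show "\<forall>\<^sub>F y in at x.
        Im ((f (complex_of_real y) - f (complex_of_real x)) / (complex_of_real y - complex_of_real x)) = 0"
      by (auto elim!: eventually_mono simp: Im_divide_of_real simp flip: of_real_diff)
  qed
  then show ?thesis by (simp add: tendsto_const_iff)
qed

lemma derivative_along_imaginary_axis:
  assumes "(f has_field_derivative D) (at 0)" "f 0 = 0"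
  shows "((\<lambda>y. f (\<i> * complex_of_real y) / (\<i> * complex_of_real y)) \<longlongrightarrow> D) (at_right 0)"
proof -
  have "((\<lambda>w. f w / w) \<longlongrightarrow> D) (at 0)" using assms by (simp add: has_field_derivative_iff)
  moreover have "filterlim (\<lambda>y. \<i> * complex_of_real y) (at 0) (at_right 0)"
    unfolding filterlim_at
    by (auto intro!: tendsto_eq_intros eventually_at_right_less[THEN eventually_mono])
  ultimately show ?thesis by (rule filterlim_compose)
qed

section \<open>Analytic continuation of the subordination functions across 0, and its
  consequences\<close>

context subordination
begin

text \<open>As \<open>\<omega>2\<close> tends to infinity at 0, \<open>s = 1 / \<omega>2\<close>
  enters the disc where \<open>P\<close> is injective, and \<open>P s = G w\<close> can be solved
  for \<open>s\<close>.\<close>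

lemma expansion_at_0:
  assumes "\<omega>2 0 = None"
  obtains \<rho> \<Phi> where "\<rho> > 0" "\<Phi> holomorphic_on ball 0 \<rho>" "\<Phi> 0 = 0"
    "(\<Phi> has_field_derivative complex_of_real (1 + law2.m2 * m)) (at 0)"
    "\<And>w. Im w > 0 \<Longrightarrow> norm w < \<rho> \<Longrightarrow> f1 w = \<Phi> w"
    "\<And>x::real. \<bar>x\<bar> < \<rho> \<Longrightarrow> Im (\<Phi> (complex_of_real x)) = 0"
proof -
  interpret swap: subordination K2 K1 \<mu>2 \<mu>1 \<mu> \<omega>2 \<omega>1 \<epsilon> by (rule swapped)
  obtain r where r: "r > 0" "r \<le> 1 / K2" and nz: "\<And>s::complex. norm s < r \<Longrightarrow> 1 + s\<^sup>2 * law2.Q s \<noteq> 0"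
    and P: "law2.P holomorphic_on ball 0 r" and H: "law2.H holomorphic_on ball 0 r"
    and inj: "inj_on law2.P (ball 0 r)"
    by (metis law2.disc_at_infinity)
  let ?V = "law2.P ` ball 0 r"
  have oV: "open ?V" by (rule open_mapping_thm3[OF P open_ball inj])
  have 0: "0 \<in> ball (0::complex) r" "0 \<in> ?V" using r(1) by (auto intro!: image_eqI[of _ _ 0])
  obtain k where k: "k holomorphic_on ?V" "\<And>s. s \<in> ball 0 r \<Longrightarrow> deriv law2.P s * deriv k (law2.P s) = 1"
    "\<And>s. s \<in> ball 0 r \<Longrightarrow> k (law2.P s) = s"
    using holomorphic_has_inverse[OF P open_ball inj] by blast
  have k0: "k 0 = 0" using k(3)[OF 0(1)] by simp
  have "deriv k 0 = 1" using k(2)[OF 0(1)] DERIV_imp_deriv[OF law2.P_derivative] by simp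
  then have dk: "(k has_field_derivative 1) (at (G 0))"
    using holomorphic_derivI[OF k(1) oV 0(2)] G_0 by simp
  have "isCont G 0"
    using G_field_differentiable[of 0] gap(1) field_differentiable_imp_continuous_at by auto
  then have "\<forall>\<^sub>F w in nhds 0. G w \<in> ?V"
    using oV 0(2) G_0 unfolding isCont_def tendsto_at_iff_tendsto_nhds by (auto dest: topological_tendstoD)
  moreover have "\<forall>\<^sub>F w in at 0 within closed_upper_half_plane. \<omega>2 w = None \<or> 1 / r < norm (f2 w)"
    unfolding f2_def using assms
    by (intro Alexandroff_compactification_tendsto_None[OF swap.continuous closed_uhp])
       (auto simp: closed_upper_half_plane_def)
  ultimately obtain \<rho>1 \<rho>2 where \<rho>1: "\<rho>1 > 0" "\<And>w. norm w < \<rho>1 \<Longrightarrow> G w \<in> ?V"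
    and \<rho>2: "\<rho>2 > 0" "\<And>w. w \<in> closed_upper_half_plane \<Longrightarrow> w \<noteq> 0 \<Longrightarrow> norm w < \<rho>2 \<Longrightarrow>
      \<omega>2 w = None \<or> 1 / r < norm (f2 w)"
    by (auto simp: eventually_nhds_metric eventually_at dist_norm)
  define \<rho> where "\<rho> = min \<epsilon> (min \<rho>1 \<rho>2)"
  have \<rho>: "\<rho> > 0" "\<rho> \<le> \<epsilon>" "\<rho> \<le> \<rho>1" "\<rho> \<le> \<rho>2" using gap(1) \<rho>1(1) \<rho>2(1) by (auto simp: \<rho>_def)
  \<comment> \<open>This is \<open>w + H s\<close> with \<open>s = k (G w)\<close>. It no longer
    mentions \<open>\<omega>2\<close> and makes sense on both sides of the real axis.\<close>
  define \<Phi> where "\<Phi> w = w + law2.H (k (G w))" for w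
  have kV: "k v \<in> ball 0 r" if "v \<in> ?V" for v using that k(3) by auto
  have GV: "G w \<in> ?V" if "norm w < \<rho>" for w using that \<rho>1(2) \<rho>(3) by auto
  show thesis
  proof
    have hG: "G holomorphic_on ball 0 \<rho>" using \<rho>(2) by (intro holomorphic_on_subset[OF G_holomorphic]) auto
    have "(k \<circ> G) holomorphic_on ball 0 \<rho>"
      using GV by (intro holomorphic_on_compose_gen[OF hG k(1)]) auto
    then have "(law2.H \<circ> (k \<circ> G)) holomorphic_on ball 0 \<rho>"
      using GV kV by (intro holomorphic_on_compose_gen[OF _ H]) auto
    then show "\<Phi> holomorphic_on ball 0 \<rho>"
      unfolding \<Phi>_def[abs_def] by (intro holomorphic_intros) (simp add: o_def)
    show "\<Phi> 0 = 0" by (simp add: \<Phi>_def G_0 k0)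
    have "(law2.H has_field_derivative - complex_of_real law2.m2) (at (k (G 0)))"
      using law2.H_derivative by (simp add: G_0 k0)
    \<comment> \<open>The chain rule gives \<open>1 + (- m2) * 1 * (- m)\<close>.\<close>
    from DERIV_chain2[OF this DERIV_chain2[OF dk G_derivative]]
    show "(\<Phi> has_field_derivative complex_of_real (1 + law2.m2 * m)) (at 0)"
      unfolding \<Phi>_def[abs_def] by (auto intro!: derivative_eq_intros)
    show "f1 w = \<Phi> w" if w: "Im w > 0" "norm w < \<rho>" for w
    proof -
      have "1 / r < norm (f2 w)"
        using \<rho>2(2)[of w] w \<rho>(4) swap.\<omega>1_eq[OF w(1)]
        by (cases "w = 0") (auto simp: closed_upper_half_plane_def)
      then have "0 < norm (f2 w)" using r(1) less_trans zero_less_divide_1_iff by blast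
      then have ne: "f2 w \<noteq> 0" and s: "norm (1 / f2 w) < r"
        using \<open>1 / r < _\<close> r(1) by (simp_all add: norm_divide field_simps)
      have lt: "norm (1 / f2 w) < 1 / K2" using s r(2) by linarith
      note near = near_infinity[OF w(1) ne lt nz[OF s]]
      have "k (G w) = 1 / f2 w" using near(1) k(3)[of "1 / f2 w"] s by simp
      then show ?thesis using near(2) by (simp add: \<Phi>_def)
    qed
    show "Im (\<Phi> (complex_of_real x)) = 0" if x: "\<bar>x\<bar> < \<rho>" for x
    proof -
      obtain s where s: "s \<in> ball 0 r" "G (complex_of_real x) = law2.P s"
        using GV[of "complex_of_real x"] x by auto
      \<comment> \<open>\<open>G\<close> is real on the reals, so injectivity of \<open>P\<close>
        forces \<open>s\<close> to be real.\<close>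
      have "law2.P (cnj s) = law2.P s"
        using cauchy_transform_cnj[of "complex_of_real x"] s(2) by (simp add: law2.P_cnj)
      then have "cnj s = s" using inj_onD[OF inj] s(1) by fastforce
      then have "cnj (law2.H s) = law2.H s" by (metis law2.H_cnj)
      then have "Im (law2.H s) = 0" by (simp add: complex_eq_iff)
      then show ?thesis using s k(3) by (simp add: \<Phi>_def)
    qed
  qed (rule \<rho>(1))
qed

text \<open>Dividing \<open>v / (v\<^sup>2 + m\<^sub>2(\<mu>\<^sub>2)) \<le> - Im G(iy)\<close>, \<open>iv = \<omega>\<^sub>2(iy)\<close>, by \<open>y\<close> and letting \<open>y \<rightarrow> 0\<close> gives
  \<open>(1 + m\<^sub>2(\<mu>\<^sub>1) m) / m\<^sub>2(\<mu>\<^sub>2) \<le> m\<close>.\<close>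

lemma m2_less:
  assumes "\<omega>1 0 = None" "law2.m2 > 0"
  shows "law1.m2 < law2.m2"
proof -
  interpret swap: subordination K2 K1 \<mu>2 \<mu>1 \<mu> \<omega>2 \<omega>1 \<epsilon> by (rule swapped)
  obtain \<rho> \<Psi> where \<rho>: "\<rho> > 0" and \<Psi>: "\<Psi> 0 = 0"
    "(\<Psi> has_field_derivative complex_of_real (1 + law1.m2 * m)) (at 0)"
    "\<And>w. Im w > 0 \<Longrightarrow> norm w < \<rho> \<Longrightarrow> f2 w = \<Psi> w"
    by (rule swap.expansion_at_0[OF assms(1), unfolded f2_swapped]) blast
  let ?d = "1 + law1.m2 * m"
  have d: "?d > 0" using law1.m2_nonneg m_pos by (simp add: add_pos_nonneg)
  define v where "v y = Im (f2 (\<i> * complex_of_real y))" for y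
  have f2: "f2 (\<i> * complex_of_real y) = \<i> * complex_of_real (v y)" if "y > 0" for y
    using Re_f2_imaginary[OF that] by (simp add: v_def complex_eq_iff)
  have lim_v: "((\<lambda>y. v y / y) \<longlongrightarrow> ?d) (at_right 0)"
  proof -
    have "((\<lambda>y. Re (\<Psi> (\<i> * complex_of_real y) / (\<i> * complex_of_real y))) \<longlongrightarrow> Re (complex_of_real ?d)) (at_right 0)"
      by (intro tendsto_Re derivative_along_imaginary_axis \<Psi>)
    moreover have "\<forall>\<^sub>F y in at_right 0. Re (\<Psi> (\<i> * complex_of_real y) / (\<i> * complex_of_real y)) = v y / y"
      using eventually_at_right_real[OF \<rho>]
    proof eventually_elim
      case (elim y)
      then have "\<Psi> (\<i> * complex_of_real y) = \<i> * complex_of_real (v y)"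
        using f2[of y] \<Psi>(3)[of "\<i> * complex_of_real y"] by (simp add: norm_mult)
      then show ?case using elim by (simp add: Re_divide_of_real flip: of_real_divide)
    qed
    ultimately show ?thesis using Lim_transform_eventually by fastforce
  qed
  have "((\<lambda>y. v y / y * y) \<longlongrightarrow> ?d * 0) (at_right 0)"
    by (intro tendsto_mult lim_v) (auto intro!: tendsto_eq_intros)
  then have "(v \<longlongrightarrow> ?d * 0) (at_right 0)"
  proof (rule Lim_transform_eventually)
    show "\<forall>\<^sub>F y in at_right 0. v y / y * y = v y"
      using eventually_at_right_less[of 0] by (rule eventually_mono) simp
  qed
  then have lim0: "(v \<longlongrightarrow> 0) (at_right 0)" by simp
  have lim_G: "((\<lambda>y. - Re (G (\<i> * complex_of_real y) / (\<i> * complex_of_real y))) \<longlongrightarrow> - Re (- complex_of_real m)) (at_right 0)"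
    by (intro tendsto_minus tendsto_Re derivative_along_imaginary_axis G_derivative G_0)
  have "?d / (0\<^sup>2 + law2.m2) \<le> - Re (- complex_of_real m)"
  proof (rule tendsto_le[OF _ lim_G])
    show "((\<lambda>y. (v y / y) / ((v y)\<^sup>2 + law2.m2)) \<longlongrightarrow> ?d / (0\<^sup>2 + law2.m2)) (at_right 0)"
      using assms(2) by (intro tendsto_intros lim_v lim0) auto
    show "\<forall>\<^sub>F y in at_right 0. (v y / y) / ((v y)\<^sup>2 + law2.m2)
        \<le> - Re (G (\<i> * complex_of_real y) / (\<i> * complex_of_real y))"
      using order_tendstoD(1)[OF lim_v d] eventually_at_right_less[of 0]
    proof eventually_elim
      case (elim y)
      then have "v y > 0" by (simp add: zero_less_divide_iff)
      then have "v y / ((v y)\<^sup>2 + law2.m2) \<le> - Im (G (\<i> * complex_of_real y))"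
        using law2.neg_Im_cauchy_transform_ge[of "v y"] f2 elim swap.G_f1[of "\<i> * complex_of_real y"]
        by (simp add: f2_swapped)
      then have "v y / ((v y)\<^sup>2 + law2.m2) / y \<le> - Im (G (\<i> * complex_of_real y)) / y"
        using elim by (intro divide_right_mono) auto
      moreover have "Re (G (\<i> * complex_of_real y) / (\<i> * complex_of_real y)) = Im (G (\<i> * complex_of_real y)) / y"
        using elim by (simp add: Re_divide power2_eq_square)
      ultimately show ?case by (simp add: mult.commute)
    qed
  qed simp
  then have "1 + law1.m2 * m \<le> law2.m2 * m"
    using assms(2) by (simp add: field_simps)
  \<comment> \<open>Strictness comes from the summand 1, the derivative of \<open>w\<close> in the
    expansion of \<open>\<omega>2\<close>.\<close>
  then have "law1.m2 * m < law2.m2 * m" by linarith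
  then show ?thesis using m_pos by simp
qed

text \<open>Approach \<open>w\<close> vertically from above: there \<open>\<omega>1\<close> agrees
  with \<open>\<Phi>\<close>, which stays bounded, so the boundary value is finite, and equals
  \<open>\<Phi> w\<close> by uniqueness of limits.\<close>

lemma \<omega>1_boundary:
  assumes cont: "isCont \<Phi> w" and eq: "\<And>w. Im w > 0 \<Longrightarrow> norm w < \<rho> \<Longrightarrow> f1 w = \<Phi> w"
    and w: "Im w \<ge> 0" "norm w < \<rho>"
  shows "\<omega>1 w = Some (\<Phi> w)"
proof -
  have wc: "w \<in> closed_upper_half_plane" using w by (simp add: closed_upper_half_plane_def)
  let ?F = "at_right (0::real)"
  have lim: "((\<lambda>y. w + \<i> * complex_of_real y) \<longlongrightarrow> w) ?F" by (auto intro!: tendsto_eq_intros)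
  have ev: "\<forall>\<^sub>F y in ?F. f1 (w + \<i> * complex_of_real y) = \<Phi> (w + \<i> * complex_of_real y) \<and>
      \<omega>1 (w + \<i> * complex_of_real y) \<noteq> None"
    using order_tendstoD(2)[OF tendsto_norm[OF lim] w(2)] eventually_at_right_less[of 0]
  proof eventually_elim
    case (elim y)
    then show ?case using eq[of "w + \<i> * complex_of_real y"] \<omega>1_eq[of "w + \<i> * complex_of_real y"] w(1) by simp
  qed
  have \<Phi>: "((\<lambda>y. \<Phi> (w + \<i> * complex_of_real y)) \<longlongrightarrow> \<Phi> w) ?F"
    by (rule isCont_tendsto_compose[OF cont lim])
  have fl: "filterlim (\<lambda>y. w + \<i> * complex_of_real y) (at w within closed_upper_half_plane) ?F"
    using w lim unfolding filterlim_at closed_upper_half_plane_def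
    by (auto intro!: eventually_at_right_less[THEN eventually_mono])
  show ?thesis
  proof (cases "\<omega>1 w")
    case None
    from Alexandroff_compactification_tendsto_None[OF continuous closed_uhp wc this, of "norm (\<Phi> w) + 1"]
    have "\<forall>\<^sub>F y in ?F. \<omega>1 (w + \<i> * complex_of_real y) = None \<or> norm (\<Phi> w) + 1 < norm (f1 (w + \<i> * complex_of_real y))"
      using fl unfolding filterlim_iff f1_def by blast
    moreover have "\<forall>\<^sub>F y in ?F. norm (\<Phi> (w + \<i> * complex_of_real y)) < norm (\<Phi> w) + 1"
      by (rule order_tendstoD(2)[OF tendsto_norm[OF \<Phi>]]) simp
    ultimately have "\<forall>\<^sub>F y in ?F. False" using ev by eventually_elim auto
    then show ?thesis by simp
  next
    case (Some c)
    then have "(f1 \<longlongrightarrow> c) (at w within closed_upper_half_plane)"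
      unfolding f1_def[abs_def] by (rule Alexandroff_compactification_tendsto_Some[OF continuous wc])
    from filterlim_compose[OF this fl] have "((\<lambda>y. \<Phi> (w + \<i> * complex_of_real y)) \<longlongrightarrow> c) ?F"
      by (rule Lim_transform_eventually) (use ev in \<open>auto elim!: eventually_mono\<close>)
    then show ?thesis using tendsto_unique[OF _ \<Phi>] Some by simp
  qed
qed

text \<open>Imaginary parts of \<open>G_f1\<close> give \<open>Im (f1 w) * ?I1 = Im w * ?I\<close>,
  hence \<open>?I1 \<le> ?I\<close>; and \<open>w\<close> keeps distance at least
  \<open>\<epsilon> / 2\<close> from almost every \<open>t\<close>.\<close>

lemma integral_inverse_norm_square_le:
  assumes "Im w > 0" "norm w < \<epsilon> / 2" "Im w \<le> Im (f1 w)"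
  shows "(\<integral>t. 1 / (norm (f1 w - complex_of_real t))\<^sup>2 \<partial>\<mu>1) \<le> 4 / \<epsilon>\<^sup>2"
proof -
  let ?I1 = "\<integral>t. 1 / (norm (f1 w - complex_of_real t))\<^sup>2 \<partial>\<mu>1"
  let ?I = "\<integral>t. 1 / (norm (w - complex_of_real t))\<^sup>2 \<partial>\<mu>"
  have "Im (f1 w) * ?I1 = Im w * ?I"
    using law1.Im_cauchy_transform[of "f1 w"] Im_cauchy_transform[of w] G_f1[of w] assms by simp
  moreover have "?I1 \<ge> 0" by (rule Bochner_Integration.integral_nonneg) simp
  ultimately have "Im w * ?I1 \<le> Im w * ?I"
    using mult_right_mono[OF assms(3), of ?I1] by simp
  then have "?I1 \<le> ?I" using assms(1) by simp
  also have "?I \<le> (\<integral>t. 4 / \<epsilon>\<^sup>2 \<partial>\<mu>)"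
  proof (rule integral_mono_AE)
    have "norm w < \<epsilon>" using assms(2) gap(1) by simp
    show "AE t in \<mu>. 1 / (norm (w - complex_of_real t))\<^sup>2 \<le> 4 / \<epsilon>\<^sup>2"
      using AE_gap[OF \<open>norm w < \<epsilon>\<close>]
    proof eventually_elim
      case (elim t)
      then have "(\<epsilon> / 2)\<^sup>2 \<le> (norm (w - complex_of_real t))\<^sup>2"
        using assms(2) gap(1) by (intro power_mono) auto
      then have "1 / (norm (w - complex_of_real t))\<^sup>2 \<le> 1 / (\<epsilon> / 2)\<^sup>2"
        using gap(1) by (intro frac_le) auto
      then show ?case by (simp add: power_divide)
    qed
  qed (use integrable_inverse_norm_square[OF assms(1)] in auto)
  finally show ?thesis by (simp add: prob_UNIV)
qed

lemma gap_near_0: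
  assumes "\<omega>2 0 = None" "law2.m2 > 0"
  shows "\<exists>\<delta>>0.
    (\<forall>x\<in>{-\<delta><..<\<delta>}.
       (\<exists>r::real. \<omega>1 (complex_of_real x) = Some (complex_of_real r)) \<and>
       (\<exists>d::real. d > 1 \<and>
          ((\<lambda>w. the (\<omega>1 w)) has_field_derivative complex_of_real d)
            (at (complex_of_real x) within closed_upper_half_plane))) \<and>
    (\<exists>r::real. \<omega>1 (complex_of_real \<delta>) = Some (complex_of_real r) \<and>
       {-r<..<r} \<inter> measure_support \<mu>1 = {})"
proof -
  obtain \<rho> \<Phi> where \<rho>: "\<rho> > 0" and hol: "\<Phi> holomorphic_on ball 0 \<rho>"
    and d0: "(\<Phi> has_field_derivative complex_of_real (1 + law2.m2 * m)) (at 0)"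
    and eq: "\<And>w. Im w > 0 \<Longrightarrow> norm w < \<rho> \<Longrightarrow> f1 w = \<Phi> w"
    and real: "\<And>x::real. \<bar>x\<bar> < \<rho> \<Longrightarrow> Im (\<Phi> (complex_of_real x)) = 0"
    by (rule expansion_at_0[OF assms(1)]) blast
  have deriv: "(\<Phi> has_field_derivative deriv \<Phi> w) (at w)" if "norm w < \<rho>" for w
    using that by (intro holomorphic_derivI[OF hol]) auto
  have boundary: "\<omega>1 w = Some (\<Phi> w)" if "Im w \<ge> 0" "norm w < \<rho>" for w
    using \<omega>1_boundary[OF DERIV_isCont[OF deriv] eq] that by blast
  \<comment> \<open>\<open>\<Phi>\<close> is imaginary on the upper half of the imaginary axis, so
    reflection makes it odd on the reals. Its image of \<open>{- \<delta>..\<delta>}\<close> then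
    reaches both \<open>- r\<close> and \<open>r\<close>.\<close>
  have odd: "Re (\<Phi> (complex_of_real (- x))) = - Re (\<Phi> (complex_of_real x))" if "\<bar>x\<bar> < \<rho>" for x
  proof -
    have "\<Phi> (- cnj (complex_of_real x)) = - cnj (\<Phi> (complex_of_real x))"
    proof (rule vertical_reflection[OF hol, of "\<rho> / 2" "\<rho> / 2"])
      fix y assume y: "\<bar>y - \<rho> / 2\<bar> < \<rho> / 2" "\<i> * complex_of_real y \<in> ball 0 \<rho>"
      then have "y > 0" by (simp add: abs_if split: if_splits)
      then show "Re (\<Phi> (\<i> * complex_of_real y)) = 0"
        using eq[of "\<i> * complex_of_real y"] Re_f1_imaginary[of y] y(2) by simp
    qed (use \<rho> that in \<open>auto simp: norm_mult\<close>)
    then show ?thesis by simp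
  qed
  have "Re (deriv \<Phi> 0) > 1"
    using DERIV_imp_deriv[OF d0] assms(2) m_pos by simp
  moreover have "isCont (deriv \<Phi>) 0"
    using holomorphic_deriv[OF hol] \<rho>
    by (intro continuous_on_interior[OF holomorphic_on_imp_continuous_on]) auto
  then have "((\<lambda>w. Re (deriv \<Phi> w)) \<longlongrightarrow> Re (deriv \<Phi> 0)) (nhds 0)"
    unfolding isCont_def tendsto_at_iff_tendsto_nhds by (rule tendsto_Re)
  ultimately have "\<forall>\<^sub>F w in nhds 0. Re (deriv \<Phi> w) > 1"
    by (intro order_tendstoD(1))
  then obtain \<rho>1 where \<rho>1_pos: "\<rho>1 > 0" and "\<forall>w. dist w 0 < \<rho>1 \<longrightarrow> Re (deriv \<Phi> w) > 1"
    unfolding eventually_nhds_metric by blast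
  then have \<rho>1: "Re (deriv \<Phi> w) > 1" if "norm w < \<rho>1" for w
    using that by simp
  \<comment> \<open>Within \<open>\<eta>\<close> the expansion is valid,
    \<open>Re (deriv \<Phi> w) > 1\<close>, and the integral bound applies.\<close>
  define \<eta> where "\<eta> = Min {\<rho>, \<rho>1, \<epsilon> / 2}"
  have \<eta>: "\<eta> > 0" "\<eta> \<le> \<rho>" "\<eta> \<le> \<rho>1" "\<eta> \<le> \<epsilon> / 2" using \<rho> \<rho>1_pos gap(1) by (auto simp: \<eta>_def)
  \<comment> \<open>Strictly below \<open>\<eta>\<close>, so that the endpoint
    \<open>\<delta>\<close> is covered as well.\<close>
  define \<delta> where "\<delta> = \<eta> / 2"
  have \<delta>: "\<delta> > 0" "\<delta> < \<eta>" using \<eta>(1) by (auto simp: \<delta>_def)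
  define \<phi> where "\<phi> x = Re (\<Phi> (complex_of_real x))" for x
  have \<phi>: "\<Phi> (complex_of_real x) = complex_of_real (\<phi> x)" if "\<bar>x\<bar> < \<eta>" for x
    using real[of x] that \<eta>(2) by (simp add: \<phi>_def complex_eq_iff)
  have \<omega>1_real: "\<omega>1 (complex_of_real x) = Some (complex_of_real (\<phi> x))" if "\<bar>x\<bar> < \<eta>" for x
    using boundary[of "complex_of_real x"] \<phi>[OF that] that \<eta>(2) by simp
  have has_deriv: "\<exists>d::real. d > 1 \<and> ((\<lambda>w. the (\<omega>1 w)) has_field_derivative complex_of_real d)
            (at (complex_of_real x) within closed_upper_half_plane)" if x: "\<bar>x\<bar> < \<eta>" for x
  proof (intro exI conjI)
    let ?x = "complex_of_real x"
    show "Re (deriv \<Phi> ?x) > 1" using \<rho>1[of ?x] x \<eta>(3) by simp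
    have D: "(\<Phi> has_field_derivative deriv \<Phi> ?x) (at ?x)" using x \<eta>(2) by (intro deriv) simp
    have "\<forall>\<^sub>F y in nhds x. Im (\<Phi> (complex_of_real y)) = 0"
    proof -
      have "\<forall>\<^sub>F y in nhds x. y \<in> {-\<rho><..<\<rho>}" using x \<eta>(2) by (intro eventually_nhds_in_open) auto
      then show ?thesis by (rule eventually_mono) (auto intro!: real)
    qed
    from Im_derivative_eq_0[OF D this] have "complex_of_real (Re (deriv \<Phi> ?x)) = deriv \<Phi> ?x"
      by (simp add: complex_eq_iff)
    moreover have "((\<lambda>w. the (\<omega>1 w)) has_field_derivative deriv \<Phi> ?x) (at ?x within closed_upper_half_plane)"
    proof (rule has_field_derivative_transform_within[OF has_field_derivative_at_within[OF D]])
      show "\<rho> - \<bar>x\<bar> > 0" using x \<eta>(2) by simp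
      show "?x \<in> closed_upper_half_plane" by (simp add: closed_upper_half_plane_def)
      fix w assume w: "w \<in> closed_upper_half_plane" "dist w ?x < \<rho> - \<bar>x\<bar>"
      then have "norm w < \<rho>" using norm_triangle_ineq2[of w ?x] by (simp add: dist_norm)
      then show "\<Phi> w = the (\<omega>1 w)" using boundary[of w] w(1) by (simp add: closed_upper_half_plane_def)
    qed
    ultimately show "((\<lambda>w. the (\<omega>1 w)) has_field_derivative complex_of_real (Re (deriv \<Phi> ?x)))
      (at ?x within closed_upper_half_plane)" by simp
  qed
  \<comment> \<open>Apply the mean value theorem to \<open>- \<i> * \<Phi>\<close> on the vertical
    segment from the real point below, where \<open>\<Phi>\<close> is real; the imaginary part grows
    at least as fast as the height.\<close>
  have Im_mono: "y \<le> Im (\<Phi> (complex_of_real x + \<i> * complex_of_real y))"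
    if "y > 0" "norm (complex_of_real x + \<i> * complex_of_real y) < \<eta>" for x y
  proof -
    let ?x = "complex_of_real x" and ?w = "complex_of_real x + \<i> * complex_of_real y"
    have x: "\<bar>x\<bar> < \<eta>" using abs_Re_le_cmod[of ?w] that(2) by simp
    have sub: "closed_segment ?x ?w \<subseteq> ball 0 \<eta>"
      using that(2) x by (intro closed_segment_subset) auto
    have "\<exists>u. u \<in> closed_segment ?x ?w \<and>
      Re (- \<i> * \<Phi> ?w) - Re (- \<i> * \<Phi> ?x) = Re (- \<i> * deriv \<Phi> u * (?w - ?x))"
    proof (rule complex_mvt_line)
      fix u assume "u \<in> closed_segment ?x ?w"
      then have "norm u < \<rho>" using sub \<eta>(2) by auto
      then show "((\<lambda>u. - \<i> * \<Phi> u) has_field_derivative - \<i> * deriv \<Phi> u) (at u)"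
        by (intro DERIV_cmult deriv)
    qed
    then obtain u where u: "u \<in> closed_segment ?x ?w" "Im (\<Phi> ?w) - Im (\<Phi> ?x) = y * Re (deriv \<Phi> u)"
      by (auto simp: algebra_simps)
    have "Re (deriv \<Phi> u) > 1" using u(1) sub \<eta>(3) \<rho>1[of u] by auto
    then have "y * 1 \<le> y * Re (deriv \<Phi> u)" using that(1) by (intro mult_left_mono) auto
    then show ?thesis using u(2) real[of x] x \<eta>(2) by simp
  qed
  define r where "r = \<phi> \<delta>"
  \<comment> \<open>The intermediate value theorem writes \<open>\<alpha>\<close> as
    \<open>\<phi> x\<close>. A point above \<open>x\<close> has \<open>f1\<close> within
    \<open>e\<close> of \<open>\<alpha>\<close>, so \<open>?N t \<le> 2 * e\<close> on the interval;
    thus \<open>prob / (4 * e\<^sup>2)\<close> is at most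
    \<open>4 / \<epsilon>\<^sup>2\<close>.\<close>
  have small: "law1.prob {\<alpha> - e..\<alpha> + e} \<le> 16 / \<epsilon>\<^sup>2 * e\<^sup>2" if \<alpha>: "\<bar>\<alpha>\<bar> < r" and e: "e > 0" for \<alpha> e
  proof -
    have "continuous_on {- \<delta>..\<delta>} \<phi>"
      unfolding \<phi>_def using \<delta> \<eta>(2)
      by (intro continuous_on_Re continuous_on_compose2[OF holomorphic_on_imp_continuous_on[OF hol]]
          continuous_intros) auto
    moreover have "\<phi> (- \<delta>) = - r" using odd[of \<delta>] \<delta> \<eta>(2) by (simp add: \<phi>_def r_def)
    moreover have "- r \<le> \<alpha>" "\<alpha> \<le> r" "- \<delta> \<le> \<delta>" using \<alpha> \<delta>(1) by linarith+
    ultimately have "\<exists>x\<ge>- \<delta>. x \<le> \<delta> \<and> \<phi> x = \<alpha>"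
      by (intro IVT') (simp_all add: r_def)
    then obtain x where x: "- \<delta> \<le> x" "x \<le> \<delta>" "\<phi> x = \<alpha>" by blast
    then have x\<eta>: "\<bar>x\<bar> < \<eta>" using \<delta> by simp
    let ?w = "\<lambda>y. complex_of_real x + \<i> * complex_of_real y"
    have lim: "(?w \<longlongrightarrow> complex_of_real x) (at_right 0)" by (auto intro!: tendsto_eq_intros)
    have "((\<lambda>y. \<Phi> (?w y)) \<longlongrightarrow> \<Phi> (complex_of_real x)) (at_right 0)"
      using x\<eta> \<eta>(2) by (intro isCont_tendsto_compose[OF DERIV_isCont[OF deriv] lim]) simp
    then have "\<forall>\<^sub>F y in at_right 0. dist (\<Phi> (?w y)) (complex_of_real \<alpha>) < e"
      using e \<phi>[OF x\<eta>] x(3) by (auto dest: tendstoD)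
    moreover have "\<forall>\<^sub>F y in at_right 0. norm (?w y) < \<eta>"
      using x\<eta> by (intro order_tendstoD(2)[OF tendsto_norm[OF lim]]) simp
    ultimately have "\<forall>\<^sub>F y in at_right 0. y > 0 \<and> norm (?w y) < \<eta> \<and> dist (\<Phi> (?w y)) (complex_of_real \<alpha>) < e"
      using eventually_at_right_less[of 0] by eventually_elim auto
    then obtain y where y: "y > 0" "norm (?w y) < \<eta>" "dist (\<Phi> (?w y)) (complex_of_real \<alpha>) < e"
      using eventually_happens[of _ "at_right (0::real)"] by auto
    have f1: "f1 (?w y) = \<Phi> (?w y)" using eq[of "?w y"] y \<eta>(2) by simp
    have pos: "Im (f1 (?w y)) > 0" using Im_mono[of y x] y f1 by simp
    let ?N = "\<lambda>t. norm (f1 (?w y) - complex_of_real t)"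
    have "law1.prob {\<alpha> - e..\<alpha> + e} / (4 * e\<^sup>2) = (\<integral>t. indicator {\<alpha> - e..\<alpha> + e} t / (4 * e\<^sup>2) \<partial>\<mu>1)"
      by simp
    also have "\<dots> \<le> (\<integral>t. 1 / (?N t)\<^sup>2 \<partial>\<mu>1)"
    proof (rule integral_mono)
      fix t
      show "indicator {\<alpha> - e..\<alpha> + e} t / (4 * e\<^sup>2) \<le> 1 / (?N t)\<^sup>2"
      proof (cases "t \<in> {\<alpha> - e..\<alpha> + e}")
        case True
        have "?N t \<le> dist (f1 (?w y)) (complex_of_real \<alpha>) + dist (complex_of_real \<alpha>) (complex_of_real t)"
          unfolding dist_norm[symmetric] by (rule dist_triangle)
        also have "\<dots> \<le> 2 * e" using y(3) True by (auto simp: f1 dist_norm simp flip: of_real_diff)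
        finally have "(?N t)\<^sup>2 \<le> (2 * e)\<^sup>2" by (intro power_mono) auto
        moreover have "f1 (?w y) \<noteq> complex_of_real t" using pos by (auto simp: complex_eq_iff)
        ultimately have "1 / (2 * e)\<^sup>2 \<le> 1 / (?N t)\<^sup>2" by (intro frac_le) auto
        then show ?thesis using True by (simp add: power_mult_distrib)
      qed auto
    qed (use law1.integrable_inverse_norm_square[OF pos] in \<open>auto intro!: integrable_divide law1.integrable_const_bound[where B = 1]\<close>)
    also have "\<dots> \<le> 4 / \<epsilon>\<^sup>2"
      using y \<eta>(4) Im_mono[of y x] f1 by (intro integral_inverse_norm_square_le) auto
    finally show ?thesis using e by (simp add: field_simps)
  qed
  have "emeasure \<mu>1 {- r<..<r} = 0" by (rule law1.emeasure_interval_eq_0[OF small])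
  then have "{-r<..<r} \<inter> measure_support \<mu>1 = {}"
    unfolding measure_support_def by (auto intro!: exI[of _ "{- r<..<r}"])
  moreover have "\<omega>1 (complex_of_real \<delta>) = Some (complex_of_real r)"
    using \<omega>1_real[of \<delta>] \<delta> by (simp add: r_def)
  moreover have "\<exists>r. \<omega>1 (complex_of_real x) = Some (complex_of_real r)" if "x \<in> {- \<delta><..<\<delta>}" for x
    using \<omega>1_real[of x] that \<delta>(2) by auto
  moreover have "\<exists>d>1. ((\<lambda>w. the (\<omega>1 w)) has_field_derivative complex_of_real d)
      (at (complex_of_real x) within closed_upper_half_plane)" if "x \<in> {- \<delta><..<\<delta>}" for x
    by (rule has_deriv) (use that \<delta>(2) in auto)
  ultimately show ?thesis using \<delta>(1) by blast
qed

end

section \<open>From operators to symmetric laws with a gap, and exclusion of an infinite value of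
  \<open>\<omega>1\<close> at 0\<close>

theorem proposition2p7:
  fixes A :: "('h::complex_hilbert_space \<Rightarrow> 'h) set"
    and \<tau> :: "('h \<Rightarrow> 'h) \<Rightarrow> complex"
    and a T p q :: "'h \<Rightarrow> 'h"
    and z :: complex
    and \<nu>1 \<nu>2 \<mu>1 \<mu>2 \<mu> :: "real measure"
    and \<omega>1 \<omega>2 :: "complex \<Rightarrow> complex option"
  assumes "tracial_von_neumann_algebra A \<tau>"
    and "a \<in> A" and "T \<in> A"
    and "freely_independent \<tau> a T"
    and "T \<noteq> (\<lambda>_. 0)" and "R_diagonal A \<tau> T"
    and "is_abs (\<lambda>\<xi>. a \<xi> - scaleC z \<xi>) p" and "spectral_distribution A \<tau> p \<nu>1"
    and "is_abs T q" and "spectral_distribution A \<tau> q \<nu>2"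
    and "\<mu>1 = symmetrization \<nu>1" and "\<mu>2 = symmetrization \<nu>2"
    and "is_free_additive_convolution TYPE('k::complex_hilbert_space) \<mu>1 \<mu>2 \<mu>"
    and "is_subordination_pair \<mu>1 \<mu>2 \<mu> \<omega>1 \<omega>2"
    and "0 \<notin> measure_support \<mu>"
    and "moment_2 \<mu>2 < 1 / moment_minus_2 \<mu>1"
  shows "\<exists>\<delta>>0.
    (\<forall>x\<in>{-\<delta><..<\<delta>}.
       (\<exists>r::real. \<omega>1 (complex_of_real x) = Some (complex_of_real r)) \<and>
       (\<exists>d::real. d > 1 \<and>
          ((\<lambda>w. the (\<omega>1 w)) has_field_derivative complex_of_real d)
            (at (complex_of_real x) within closed_upper_half_plane))) \<and>
    (\<exists>r::real. \<omega>1 (complex_of_real \<delta>) = Some (complex_of_real r) \<and>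
       {-r<..<r} \<inter> measure_support \<mu>1 = {})"
proof -
  obtain K1 where K1: "real_distribution \<nu>1" "K1 > 0" "AE t in \<nu>1. \<bar>t\<bar> \<le> K1"
    using spectral_distribution_bounded[OF assms(1,8)] by blast
  obtain K2 where K2: "real_distribution \<nu>2" "K2 > 0" "AE t in \<nu>2. \<bar>t\<bar> \<le> K2"
    using spectral_distribution_bounded[OF assms(1,10)] by blast
  obtain B :: "('k \<Rightarrow> 'k) set" and \<phi> s
    where "tracial_von_neumann_algebra B \<phi>" "spectral_distribution B \<phi> s \<mu>"
    using assms(13) unfolding is_free_additive_convolution_def by blast
  then interpret law: real_distribution \<mu> by (rule spectral_distribution_bounded)
  obtain U where U: "open U" "0 \<in> U" "emeasure \<mu> U = 0"
    using assms(15) by (auto simp: measure_support_def)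
  obtain \<epsilon> where \<epsilon>: "\<epsilon> > 0" "ball 0 \<epsilon> \<subseteq> U" using U(1,2) open_contains_ball by blast
  have "emeasure \<mu> (ball 0 \<epsilon>) = 0"
    using emeasure_mono[OF \<epsilon>(2), of \<mu>] U by simp
  then have "AE t in \<mu>. \<epsilon> \<le> \<bar>t\<bar>"
    by (subst AE_iff_measurable[where N = "ball 0 \<epsilon>"]) auto
  then interpret subordination K1 K2 \<mu>1 \<mu>2 \<mu> \<omega>1 \<omega>2 \<epsilon>
    unfolding assms(11,12)
    by (intro subordination.intro subordination_axioms.intro symmetric_law_symmetrization K1 K2
        law.real_distribution_axioms assms(14)[unfolded assms(11,12)] \<epsilon>(1))
  interpret \<nu>2: real_distribution \<nu>2 by (rule K2)
  have "emeasure \<mu>2 (- {0}) \<noteq> 0"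
    using spectral_distribution_nonzero[OF assms(1,3,5,9,10)]
    by (simp add: assms(12) emeasure_symmetrization ennreal_divide_eq_0_iff)
  then have pos: "law2.m2 > 0" by (rule law2.m2_pos)
  have "\<omega>1 0 \<noteq> None"
  proof
    assume "\<omega>1 0 = None"
    then have "law1.m2 < law2.m2" using pos by (rule m2_less)
    \<comment> \<open>The tangent bound for \<open>m\<^sub>-\<^sub>2(\<mu>1)\<close> with
      \<open>c = 1 / law2.m2\<close> yields
      \<open>1 / law2.m2 \<le> m\<^sub>-\<^sub>2(\<mu>1)\<close>, against the hypothesis on the
      moments.\<close>
    then have "1 / law2.m2 \<le> 2 * (1 / law2.m2) - (1 / law2.m2)\<^sup>2 * law1.m2"
      using pos by (simp add: field_simps power2_eq_square)
    then have "ennreal (1 / law2.m2) \<le> moment_minus_2 \<mu>1"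
      using law1.moment_minus_2_ge[of "1 / law2.m2"] ennreal_leI order_trans by blast
    moreover have "ennreal law2.m2 * ennreal (1 / law2.m2) = 1"
      using pos by (simp flip: ennreal_mult')
    ultimately have le: "1 \<le> moment_minus_2 \<mu>1 * ennreal law2.m2"
      using mult_left_mono[of "ennreal (1 / law2.m2)" "moment_minus_2 \<mu>1" "ennreal law2.m2"]
      by (simp add: mult.commute)
    then have "moment_minus_2 \<mu>1 \<noteq> 0" by auto
    then have "moment_minus_2 \<mu>1 > 0" by (simp add: zero_less_iff_neq_zero)
    then have "1 / moment_minus_2 \<mu>1 \<le> ennreal law2.m2"
      using le by (rule divide_le_posI_ennreal)
    then show False using assms(16) by (simp add: law2.moment_2_eq)
  qed
  with \<omega>_None have "\<omega>2 0 = None" by fastforce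
  then show ?thesis using pos by (rule gap_near_0)
qed

end
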